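(* Let $\mathbf N_k=N^0_{s-1}:=\{0,1,\dots,s-1\}$ for all $k\in\mathbb N$ (with $s\ge 2$), let $\mathbf V_0=\{v_1,v_2,\dots,v_m\}\subset N^0_{s-1}$, and let the $\widetilde Q$-matrix $\widetilde Q=\|q_{ik}\|$ have the following asymptotic property: $$\lim_{k\to\infty}q_{ik}=q_i,\qquad i\in N^0_{s-1}.$$ Then: 1) the Hausdorff–Besicovitch dimension of the set $$\Gamma_{\widetilde Q(\mathbf V_0)}=\{x\in[0,1]:\ x=\Delta^{\widetilde Q}_{i_1i_2\dots i_k\dots},\ i_k\in\mathbf V_0\text{ for all }k\}$$ is the root $x$ of the equation $$\sum_{i\in\mathbf V_0}q_i^x=1;$$ 2) if $$M[\widetilde Q,(\nu_0,\dots,\nu_{s-1})]=\Big\{x:\ x=\Delta^{\widetilde Q}_{\alpha_1(x)\dots\alpha_k(x)\dots},\ \lim_{k\to\infty}\frac{N_i(x,k)}{k}=\nu_i,\ i\in N^0_{s-1}\Big\},$$ where $N_i(x,k)$ is the number of symbols "$i$" among the first $k$ symbols of the $\widetilde Q$-representation of $x$, then $$\alpha_0\big(M[\widetilde Q,(\nu_0,\dots,\nu_{s-1})]\big)=\frac{\sum_{i=0}^{s-1}\nu_i\ln\nu_i}{\sum_{i=0}^{s-1}\nu_i\ln q_i}.$$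
   Context: $\widetilde Q$-matrix (here with $\mathbf N_k=\{0,\dots,s-1\}$ for all $k\in\mathbb N=\{1,2,\dots\}$): a family $q_{ik}$ ($i\in\mathbf N_k$, $k\in\mathbb N$) with $q_{ik}>0$, $\sum_{i\in\mathbf N_k}q_{ik}=1$ for each $k$, and $\prod_{k=1}^\infty\max_{i\in\mathbf N_k}q_{ik}=0$. Intervals and representation: $[0,1]$ is decomposed from left to right, in increasing order of $i_1\in\mathbf N_1$, into closed intervals $\Delta^{\widetilde Q}_{i_1}$ without common interior points, of length $q_{i_1 1}$; inductively each $\Delta^{\widetilde Q}_{i_1\dots i_{k-1}}$ is decomposed from left to right, in increasing order of $i_k\in\mathbf N_k$, into closed intervals $\Delta^{\widetilde Q}_{i_1\dots i_k}$ without common interior points, of length $\prod_{l=1}^k q_{i_l l}$. For a sequence $(i_k)$ with $i_k\in\mathbf N_k$, $\Delta^{\widetilde Q}_{i_1i_2\dots i_k\dots}$ denotes the unique point of $\bigcap_k\Delta^{\widetilde Q}_{i_1\dots i_k}$; if $x$ is this point, this notation is called the $\widetilde Q$-representation of $x$, with symbols $i_k$ (it is unique for all $x\in[0,1]$ except countably many points, which have two representations). The numbers $\nu_0,\dots,\nu_{s-1}$ are the prescribed asymptotic frequencies of the symbols $0,\dots,s-1$. $\alpha_0(E)$ denotes the Hausdorff–Besicovitch dimension of $E$.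
   Formalization: Part 1 assumes some q_i with i in V_0 is positive and none equals 1 (otherwise the equation has no root or every x>0 is one; 0^x is read as 0); part 2 assumes the denominator is nonzero (otherwise 0/0), with ln 0 = -infinity and 0 ln 0 = 0. *)

theory Defs
  imports "HOL-Analysis.Analysis"
begin

text \<open>
  Powers of diameters: the empty set contributes 0, and a nonempty set contributes 1 when
  \<open>\<alpha> = 0\<close> (this differs from \<open>powr\<close>, where \<open>0 powr 0 = 0\<close>), so that the
  0-dimensional measure counts points.
\<close>

definition diam_pow :: "real \<Rightarrow> 'a::metric_space set \<Rightarrow> ennreal" where
  "diam_pow \<alpha> U = (if U = {} then 0 else if \<alpha> = 0 then 1 else ennreal (diameter U powr \<alpha>))"

definition hausdorff_premeasure :: "real \<Rightarrow> real \<Rightarrow> 'a::metric_space set \<Rightarrow> ennreal" where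
  "hausdorff_premeasure \<alpha> \<epsilon> E =
     Inf {\<Sum>n. diam_pow \<alpha> (U n) | U :: nat \<Rightarrow> 'a set.
            E \<subseteq> (\<Union>n. U n) \<and> (\<forall>n. bounded (U n) \<and> diameter (U n) \<le> \<epsilon>)}"

definition hausdorff_measure :: "real \<Rightarrow> 'a::metric_space set \<Rightarrow> ennreal" where
  "hausdorff_measure \<alpha> E = (SUP \<epsilon>\<in>{0<..}. hausdorff_premeasure \<alpha> \<epsilon> E)"

definition hausdorff_dim :: "'a::metric_space set \<Rightarrow> ereal" where
  "hausdorff_dim E = Inf {ereal \<alpha> | \<alpha>. 0 \<le> \<alpha> \<and> hausdorff_measure \<alpha> E = 0}"

text \<open>
  The entry \<open>q i k\<close> belongs to the symbol \<open>i \<in> {0..<s}\<close> and to the position \<open>k\<close>.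
  Positions are counted from 0, so \<open>q i k\<close> is the entry with second index \<open>k + 1\<close>
  when positions are counted from 1.
\<close>

definition Q_tilde_matrix :: "nat \<Rightarrow> (nat \<Rightarrow> nat \<Rightarrow> real) \<Rightarrow> bool" where
  "Q_tilde_matrix s q \<longleftrightarrow>
     (\<forall>k. \<forall>i<s. 0 < q i k) \<and>
     (\<forall>k. (\<Sum>i<s. q i k) = 1) \<and>
     (\<lambda>n. \<Prod>k<n. Max ((\<lambda>i. q i k) ` {..<s})) \<longlonglongrightarrow> 0"

text \<open>
  The cylinder of rank \<open>n\<close> of a symbol sequence \<open>a\<close> depends on \<open>a 0, \<dots>, a (n - 1)\<close> only.
  In the left-to-right decomposition of a cylinder of rank \<open>n\<close> the part with symbol \<open>i\<close>
  is preceded by the parts with symbols \<open>j < i\<close>, whose relative lengths are \<open>q j n\<close>.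
\<close>

definition cyl_length :: "(nat \<Rightarrow> nat \<Rightarrow> real) \<Rightarrow> (nat \<Rightarrow> nat) \<Rightarrow> nat \<Rightarrow> real" where
  "cyl_length q a n = (\<Prod>k<n. q (a k) k)"

primrec cyl_left :: "(nat \<Rightarrow> nat \<Rightarrow> real) \<Rightarrow> (nat \<Rightarrow> nat) \<Rightarrow> nat \<Rightarrow> real" where
  "cyl_left q a 0 = 0"
| "cyl_left q a (Suc n) = cyl_left q a n + (\<Sum>j<a n. q j n) * cyl_length q a n"

definition cylinder :: "(nat \<Rightarrow> nat \<Rightarrow> real) \<Rightarrow> (nat \<Rightarrow> nat) \<Rightarrow> nat \<Rightarrow> real set" where
  "cylinder q a n = {cyl_left q a n .. cyl_left q a n + cyl_length q a n}"

definition Q_point :: "(nat \<Rightarrow> nat \<Rightarrow> real) \<Rightarrow> (nat \<Rightarrow> nat) \<Rightarrow> real" where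
  "Q_point q a = (THE x. x \<in> (\<Inter>n. cylinder q a n))"

definition Gamma_set :: "(nat \<Rightarrow> nat \<Rightarrow> real) \<Rightarrow> nat set \<Rightarrow> real set" where
  "Gamma_set q V = {x \<in> {0..1}. \<exists>a. (\<forall>k. a k \<in> V) \<and> x = Q_point q a}"

definition symbol_count :: "(nat \<Rightarrow> nat) \<Rightarrow> nat \<Rightarrow> nat \<Rightarrow> nat" where
  "symbol_count a i n = card {k. k < n \<and> a k = i}"

text \<open>
  A point with two representations belongs to \<open>M_set\<close> as soon as one of them has the
  prescribed frequencies; there are only countably many such points.
\<close>

definition M_set :: "nat \<Rightarrow> (nat \<Rightarrow> nat \<Rightarrow> real) \<Rightarrow> (nat \<Rightarrow> real) \<Rightarrow> real set" where
  "M_set s q \<nu> = {x \<in> {0..1}. \<exists>a. (\<forall>k. a k < s) \<and> x = Q_point q a \<and>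
      (\<forall>i<s. (\<lambda>n. real (symbol_count a i n) / real n) \<longlonglongrightarrow> \<nu> i)}"

text \<open>
  The logarithm with \<open>ln 0 = -\<infinity>\<close>. Since \<open>0 * (-\<infinity>) = 0\<close> in \<^typ>\<open>ereal\<close>, this gives
  the usual reading \<open>0 ln 0 = 0\<close> in entropy sums.
\<close>

definition ln_ext :: "real \<Rightarrow> ereal" where
  "ln_ext x = (if x = 0 then -\<infinity> else ereal (ln x))"

lemma cylinder_Suc_subset:
  assumes "Q_tilde_matrix s q" "\<And>k. a k < s"
  shows "cylinder q a (Suc n) \<subseteq> cylinder q a n"
proof -
  have pos: "0 \<le> q j n" if "j < s" for j
    using assms(1) that by (auto simp: Q_tilde_matrix_def less_imp_le)
  have L: "0 \<le> cyl_length q a n"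
    using assms unfolding Q_tilde_matrix_def cyl_length_def
    by (intro prod_nonneg) (auto simp: less_imp_le)
  have le1: "(\<Sum>j<Suc (a n). q j n) \<le> 1"
  proof -
    have "(\<Sum>j<Suc (a n). q j n) \<le> (\<Sum>j<s. q j n)"
      using assms(2)[of n] pos by (intro sum_mono2) auto
    also have "\<dots> = 1" using assms(1) by (simp add: Q_tilde_matrix_def)
    finally show ?thesis .
  qed
  have ge0: "0 \<le> (\<Sum>j<a n. q j n)"
    using assms(2)[of n] pos by (intro sum_nonneg) auto
  have "(\<Sum>j<Suc (a n). q j n) * cyl_length q a n \<le> 1 * cyl_length q a n"
    by (rule mult_right_mono[OF le1 L])
  then have "(\<Sum>j<a n. q j n) * cyl_length q a n + q (a n) n * cyl_length q a n \<le> cyl_length q a n"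
    by (simp add: distrib_right)
  moreover have "0 \<le> (\<Sum>j<a n. q j n) * cyl_length q a n"
    using ge0 L by simp
  moreover have "cyl_length q a (Suc n) = q (a n) n * cyl_length q a n"
    by (simp add: cyl_length_def)
  ultimately show ?thesis
    unfolding cylinder_def cyl_left.simps atLeastatMost_subset_iff by linarith
qed

lemma Q_point_unique:
  assumes Q: "Q_tilde_matrix s q" and a: "\<And>k. a k < s"
  shows "(\<Inter>n. cylinder q a n) = {Q_point q a}"
proof -
  have pos: "0 < q (a k) k" for k
    using Q a by (auto simp: Q_tilde_matrix_def)
  have L: "0 \<le> cyl_length q a n" for n
    unfolding cyl_length_def using pos by (intro prod_nonneg) (auto simp: less_imp_le)
  have up: "cyl_length q a n \<le> (\<Prod>k<n. Max ((\<lambda>i. q i k) ` {..<s}))" for n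
    unfolding cyl_length_def
  proof (rule prod_mono)
    fix k
    have "q (a k) k \<in> (\<lambda>i. q i k) ` {..<s}" using a[of k] by blast
    then have "q (a k) k \<le> Max ((\<lambda>i. q i k) ` {..<s})" by (intro Max_ge) simp_all
    then show "0 \<le> q (a k) k \<and> q (a k) k \<le> Max ((\<lambda>i. q i k) ` {..<s})"
      using pos[of k] by simp
  qed
  have lim: "(\<lambda>n. \<Prod>k<n. Max ((\<lambda>i. q i k) ` {..<s})) \<longlonglongrightarrow> 0"
    using Q by (simp add: Q_tilde_matrix_def)
  have len0: "cyl_length q a \<longlonglongrightarrow> 0"
    by (rule tendsto_sandwich[OF always_eventually[OF allI[OF L]]
          always_eventually[OF allI[OF up]] tendsto_const lim])
  have "\<exists>x. \<forall>n. x \<in> cylinder q a n"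
  proof -
    have dec: "cylinder q a n \<subseteq> cylinder q a m" if "m \<le> n" for m n
      using that
    proof (induction n rule: dec_induct)
      case (step n)
      have "cylinder q a (Suc n) \<subseteq> cylinder q a n" by (rule cylinder_Suc_subset[OF Q a])
      then show ?case using step.IH by (rule order_trans)
    qed simp
    have "\<Inter>(range (cylinder q a)) \<noteq> {}"
      proof (rule compact_nest)
      show "compact (cylinder q a n)" "cylinder q a n \<noteq> {}" for n
        using L[of n] by (simp_all add: cylinder_def)
    qed (rule dec)
    then show ?thesis by auto
  qed
  then obtain x where x: "x \<in> cylinder q a n" for n by blast
  have uniq: "y = x" if y: "\<And>n. y \<in> cylinder q a n" for y
  proof -
    have "\<bar>y - x\<bar> \<le> cyl_length q a n" for n
      using x[of n] y[of n] by (auto simp: cylinder_def)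
    then have "\<bar>y - x\<bar> \<le> 0"
      using LIMSEQ_le_const[OF len0] by blast
    then show ?thesis by simp
  qed
  then have "(\<Inter>n. cylinder q a n) = {x}" using x by auto
  then show ?thesis by (simp add: Q_point_def)
qed

end

theory Submission
  imports Defs "HOL-Probability.Hoeffding" "HOL-Probability.Infinite_Product_Measure"
begin

text \<open>
  Both dimensions result from comparing, on the cylinders of the expansion, the \<open>t\<close>-th power of the
  length with a second multiplicative quantity, a weight whose sum over all words of a given length
  is at most 1.

  If along every sequence of a set the \<open>t\<close>-th power of the length is eventually at most the weight
  times a summable factor, then cylinders of high rank form coverings of arbitrarily small cost, and
  the points of the set have \<open>t\<close>-dimensional measure 0 (\<open>hausdorff_measure_zero_of_weights\<close>).
  If the weights define a product probability measure on sequences under which almost every sequence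
  belongs to the set and has weights bounded by a multiple of the \<open>t\<close>-th power of the length, then
  the measure is positive (\<open>hausdorff_measure_pos_of_product_measure\<close>). The second statement
  requires a lower bound for the entries of the symbols in use: a set of diameter \<open>r\<close> then meets
  only boundedly many cylinders of length comparable to \<open>r\<close> (\<open>few_stopped_cylinders_meet\<close>).

  For sequences over \<open>V0\<close> the weights are \<open>q i k powr t\<close>, divided by their sum over \<open>V0\<close>, which
  tends to \<open>\<Sum>i\<in>V0. q_lim i powr t\<close>. This limit is less than 1 for \<open>t\<close> above the root and equal to
  1 at the root.

  For prescribed frequencies the weights are the \<open>\<nu> i\<close>. Along a sequence with these frequencies the
  logarithms of weight and length are asymptotically \<open>n\<close> times the numerator and the
  denominator of the dimension formula, so that the quotient is the exponent at which they balance
  (\<open>eventually_sum_along_frequencies_le\<close>). Almost every sequence has these frequencies by the strong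
  law of large numbers (\<open>AE_symbol_frequency\<close>). If the denominator is \<open>-\<infinity>\<close>, the measure
  is 0 for every positive exponent, which gives dimension 0.
\<close>

section \<open>Hausdorff measure and dimension\<close>

lemma diam_pow_pos_exponent: "0 < t \<Longrightarrow> diam_pow t U = ennreal (diameter U powr t)"
  by (simp add: diam_pow_def)

lemma hausdorff_premeasure_le:
  assumes "E \<subseteq> (\<Union>n. U n)" "\<And>n::nat. bounded (U n)" "\<And>n. diameter (U n) \<le> \<epsilon>"
  shows "hausdorff_premeasure \<alpha> \<epsilon> E \<le> (\<Sum>n. diam_pow \<alpha> (U n))"
  unfolding hausdorff_premeasure_def using assms by (intro Inf_lower) blast

lemma hausdorff_premeasure_le_measure:
  "0 < \<epsilon> \<Longrightarrow> hausdorff_premeasure \<alpha> \<epsilon> E \<le> hausdorff_measure \<alpha> E"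
  unfolding hausdorff_measure_def by (intro SUP_upper) simp

lemma hausdorff_measure_empty: "hausdorff_measure \<alpha> {} = 0"
proof -
  have "hausdorff_premeasure \<alpha> \<epsilon> {} \<le> 0" if "0 < \<epsilon>" for \<epsilon>
    using hausdorff_premeasure_le[of "{}" "\<lambda>_. {}" \<epsilon> \<alpha>] that by (simp add: diam_pow_def)
  then have "hausdorff_measure \<alpha> {} \<le> 0"
    unfolding hausdorff_measure_def by (intro SUP_least) auto
  then show ?thesis by simp
qed

lemma hausdorff_measure_0_ge_1:
  assumes "E \<noteq> {}"
  shows "1 \<le> hausdorff_measure 0 E"
proof -
  have "1 \<le> hausdorff_premeasure 0 1 E"
    unfolding hausdorff_premeasure_def
  proof (rule Inf_greatest, safe)
    fix U :: "nat \<Rightarrow> 'a set" assume "E \<subseteq> (\<Union>n. U n)"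
    then obtain n where "U n \<noteq> {}" using assms by blast
    then have "1 = (\<Sum>m\<in>{n}. diam_pow 0 (U m))" by (simp add: diam_pow_def)
    also have "\<dots> \<le> (\<Sum>m. diam_pow 0 (U m))" by (intro sum_le_suminf) auto
    finally show "1 \<le> (\<Sum>m. diam_pow 0 (U m))" .
  qed
  then show ?thesis
    using hausdorff_premeasure_le_measure[of 1 0 E] by simp
qed

text \<open>
  The lower bound says that every exponent with null measure is at least \<open>d\<close>. The exponent 0 has a
  separate argument: if \<open>d > 0\<close>, the set has positive measure for some exponent, so it is nonempty,
  and a nonempty set has 0-dimensional measure at least 1.
\<close>

lemma hausdorff_dim_eqI:
  assumes d: "0 \<le> d"
    and null: "\<And>t. d < t \<Longrightarrow> hausdorff_measure t E = 0"
    and pos: "\<And>t. 0 < t \<Longrightarrow> t < d \<Longrightarrow> hausdorff_measure t E \<noteq> 0"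
  shows "hausdorff_dim E = ereal d"
proof (rule antisym)
  show "hausdorff_dim E \<le> ereal d"
  proof (rule dense_ge)
    fix x assume "ereal d < x"
    then obtain t where t: "ereal d < ereal t" "ereal t < x"
      using ereal_dense2 by blast
    then have "hausdorff_dim E \<le> ereal t"
      unfolding hausdorff_dim_def using null[of t] d by (intro Inf_lower) auto
    then show "hausdorff_dim E \<le> x" using t(2) by simp
  qed
  have "d \<le> \<alpha>" if \<alpha>: "0 \<le> \<alpha>" "hausdorff_measure \<alpha> E = 0" for \<alpha>
  proof (rule ccontr)
    assume less: "\<not> d \<le> \<alpha>"
    show False
    proof (cases "\<alpha> = 0")
      case True
      then have "hausdorff_measure (d / 2) E \<noteq> 0" using pos[of "d / 2"] less by simp
      then have "E \<noteq> {}" using hausdorff_measure_empty by metis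
      then show False using hausdorff_measure_0_ge_1[of E] \<alpha> True by simp
    qed (use pos[of \<alpha>] \<alpha> less in auto)
  qed
  then show "ereal d \<le> hausdorff_dim E"
    unfolding hausdorff_dim_def by (intro Inf_greatest) auto
qed

text \<open>
  Coverings by cylinders are naturally indexed by the rank and, for each rank, by finitely many
  words. This turns such a covering into the singly indexed coverings that define the premeasure;
  the gaps in the enumeration are filled with empty sets, which cost nothing.
\<close>

lemma hausdorff_premeasure_le_finite_families:
  fixes U :: "nat \<Rightarrow> 'i \<Rightarrow> 'a::metric_space set"
  assumes fin: "\<And>n. finite (I n)" and cov: "E \<subseteq> (\<Union>n. \<Union>i\<in>I n. U n i)"
    and bnd: "\<And>n i. i \<in> I n \<Longrightarrow> bounded (U n i)"
    and diam: "\<And>n i. i \<in> I n \<Longrightarrow> diameter (U n i) \<le> \<epsilon>" and "0 \<le> \<epsilon>"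
  shows "hausdorff_premeasure \<alpha> \<epsilon> E \<le> (\<Sum>n. \<Sum>i\<in>I n. diam_pow \<alpha> (U n i))"
proof -
  have "\<exists>h. bij_betw h {..<card (I n)} (I n)" for n
    using ex_bij_betw_nat_finite[OF fin[of n]] by (simp add: atLeast0LessThan)
  then obtain h where h: "bij_betw (h n) {..<card (I n)} (I n)" for n by metis
  define V where "V n j = (if j < card (I n) then U n (h n j) else {})" for n j
  define W where "W k = (case prod_decode k of (n, j) \<Rightarrow> V n j)" for k
  have hI: "h n j \<in> I n" if "j < card (I n)" for n j
    using h[of n] that by (auto simp: bij_betw_def)
  have V: "bounded (V n j)" "diameter (V n j) \<le> \<epsilon>" for n j
    using bnd diam hI \<open>0 \<le> \<epsilon>\<close> by (auto simp: V_def)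
  have "E \<subseteq> (\<Union>k. W k)"
  proof
    fix x assume "x \<in> E"
    then obtain n i where ni: "i \<in> I n" "x \<in> U n i" using cov by blast
    then obtain j where "j < card (I n)" "h n j = i"
      using h[of n] by (metis bij_betw_iff_bijections lessThan_iff)
    then have "x \<in> W (prod_encode (n, j))" using ni by (simp add: W_def V_def)
    then show "x \<in> (\<Union>k. W k)" by blast
  qed
  then have "hausdorff_premeasure \<alpha> \<epsilon> E \<le> (\<Sum>k. diam_pow \<alpha> (W k))"
    by (rule hausdorff_premeasure_le) (auto simp: W_def V split: prod.split)
  also have "\<dots> = (\<Sum>k. (\<lambda>(n, j). diam_pow \<alpha> (V n j)) (prod_decode k))"
    by (simp add: W_def case_prod_beta)
  also have "\<dots> = (\<Sum>n. \<Sum>j. diam_pow \<alpha> (V n j))"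
    by (rule suminf_ennreal_2dimen) simp
  also have "\<dots> = (\<Sum>n. \<Sum>i\<in>I n. diam_pow \<alpha> (U n i))"
  proof (rule suminf_cong)
    fix n
    have "(\<Sum>j. diam_pow \<alpha> (V n j)) = (\<Sum>j<card (I n). diam_pow \<alpha> (V n j))"
      by (rule suminf_finite) (auto simp: V_def diam_pow_def)
    also have "\<dots> = (\<Sum>j<card (I n). diam_pow \<alpha> (U n (h n j)))"
      by (simp add: V_def)
    also have "\<dots> = (\<Sum>i\<in>I n. diam_pow \<alpha> (U n i))"
      by (rule sum.reindex_bij_betw[OF h])
    finally show "(\<Sum>j. diam_pow \<alpha> (V n j)) = (\<Sum>i\<in>I n. diam_pow \<alpha> (U n i))" .
  qed
  finally show ?thesis .
qed

section \<open>Cylinders\<close>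

lemma cyl_length_cong: "(\<And>k. k < n \<Longrightarrow> a k = b k) \<Longrightarrow> cyl_length q a n = cyl_length q b n"
  unfolding cyl_length_def by (intro prod.cong) auto

lemma cyl_left_cong: "(\<And>k. k < n \<Longrightarrow> a k = b k) \<Longrightarrow> cyl_left q a n = cyl_left q b n"
proof (induction n)
  case (Suc n)
  then show ?case using cyl_length_cong[of n a b q] by simp
qed simp

lemma cylinder_cong: "(\<And>k. k < n \<Longrightarrow> a k = b k) \<Longrightarrow> cylinder q a n = cylinder q b n"
  unfolding cylinder_def using cyl_length_cong[of n a b q] cyl_left_cong[of n a b q] by simp

lemma cyl_length_0 [simp]: "cyl_length q a 0 = 1"
  by (simp add: cyl_length_def)

lemma cyl_length_Suc: "cyl_length q a (Suc n) = q (a n) n * cyl_length q a n"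
  by (simp add: cyl_length_def)

locale Q_tilde =
  fixes s :: nat and q :: "nat \<Rightarrow> nat \<Rightarrow> real"
  assumes Q: "Q_tilde_matrix s q"
begin

lemma q_pos: "i < s \<Longrightarrow> 0 < q i k"
  using Q by (simp add: Q_tilde_matrix_def)

lemma q_sum: "(\<Sum>i<s. q i k) = 1"
  using Q by (simp add: Q_tilde_matrix_def)

lemma cyl_length_pos: "(\<And>k. k < n \<Longrightarrow> a k < s) \<Longrightarrow> 0 < cyl_length q a n"
  unfolding cyl_length_def using q_pos by (intro prod_pos) auto

lemma eventually_cyl_length_le:
  assumes "0 < \<epsilon>"
  shows "\<forall>\<^sub>F n in sequentially. \<forall>a. (\<forall>k<n. a k < s) \<longrightarrow> cyl_length q a n \<le> \<epsilon>"
proof -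
  have "(\<lambda>n. \<Prod>k<n. Max ((\<lambda>i. q i k) ` {..<s})) \<longlonglongrightarrow> 0"
    using Q by (simp add: Q_tilde_matrix_def)
  then have "\<forall>\<^sub>F n in sequentially. (\<Prod>k<n. Max ((\<lambda>i. q i k) ` {..<s})) < \<epsilon>"
    using assms by (rule order_tendstoD)
  then show ?thesis
  proof eventually_elim
    case (elim n)
    show ?case
    proof safe
      fix a assume a: "\<forall>k<n. a k < s"
      have "cyl_length q a n \<le> (\<Prod>k<n. Max ((\<lambda>i. q i k) ` {..<s}))"
        unfolding cyl_length_def
        using a q_pos by (intro prod_mono conjI Max_ge) (auto simp: less_imp_le)
      then show "cyl_length q a n \<le> \<epsilon>" using elim by simp
    qed
  qed
qed

lemma cylinder_antimono:
  assumes "\<And>k. a k < s" "m \<le> n"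
  shows "cylinder q a n \<subseteq> cylinder q a m"
  using assms(2)
proof (induction n rule: dec_induct)
  case (step n)
  then show ?case using cylinder_Suc_subset[OF Q, of a n] assms(1) by blast
qed simp

lemma Q_point_in_cylinder: "(\<And>k. a k < s) \<Longrightarrow> Q_point q a \<in> cylinder q a n"
  using Q_point_unique[OF Q, of a] by blast

lemma Q_point_in_unit_interval: "(\<And>k. a k < s) \<Longrightarrow> Q_point q a \<in> {0..1}"
  using Q_point_in_cylinder[of a 0] by (simp add: cylinder_def)

text \<open>
  At the first position where two sequences differ they choose different parts of a common
  interval, so the whole cylinder of the smaller one lies to the left of the cylinder of the other,
  whatever the two ranks. In particular, left endpoints of incomparable cylinders differ by at least
  the length of the left one, which allows cylinders to be counted by their left endpoints alone.
\<close>

lemma cylinders_ordered: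
  assumes a: "\<And>k. a k < s" and b: "\<And>k. b k < s"
    and agree: "\<And>j. j < k \<Longrightarrow> a j = b j" and less: "a k < b k" and kn: "k < n" "k < m"
  shows "cyl_left q a n + cyl_length q a n \<le> cyl_left q b m"
proof -
  have nonneg: "0 \<le> cyl_length q a n" "0 \<le> cyl_length q b n" for n
    using cyl_length_pos a b by (simp_all add: less_imp_le)
  have "cyl_left q a n + cyl_length q a n \<le> cyl_left q a (Suc k) + cyl_length q a (Suc k)"
    using cylinder_antimono[of a "Suc k" n] a kn nonneg[of n] by (auto simp: cylinder_def)
  also have "\<dots> = cyl_left q a k + (\<Sum>j<Suc (a k). q j k) * cyl_length q a k"
    by (simp add: cyl_length_Suc algebra_simps)
  also have "\<dots> = cyl_left q b k + (\<Sum>j<Suc (a k). q j k) * cyl_length q b k"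
    using cyl_left_cong[of k a b q] cyl_length_cong[of k a b q] agree by simp
  also have "(\<Sum>j<Suc (a k). q j k) \<le> (\<Sum>j<b k. q j k)"
    using less b[of k] q_pos by (intro sum_mono2) (auto intro!: less_imp_le)
  then have "cyl_left q b k + (\<Sum>j<Suc (a k). q j k) * cyl_length q b k
      \<le> cyl_left q b k + (\<Sum>j<b k. q j k) * cyl_length q b k"
    using nonneg by (intro add_left_mono mult_right_mono)
  also have "\<dots> = cyl_left q b (Suc k)" by simp
  also have "\<dots> \<le> cyl_left q b m"
    using cylinder_antimono[of b "Suc k" m] b kn nonneg[of m] by (auto simp: cylinder_def)
  finally show ?thesis .
qed

lemma diameter_cylinder:
  assumes "\<And>k. k < n \<Longrightarrow> a k < s"
  shows "diameter (cylinder q a n) = cyl_length q a n"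
  using cyl_length_pos[of n a] assms by (simp add: cylinder_def)

lemma diam_pow_cylinder:
  assumes "0 < t" "\<And>k. k < n \<Longrightarrow> a k < s"
  shows "diam_pow t (cylinder q a n) = ennreal (cyl_length q a n powr t)"
  using assms by (simp add: diam_pow_pos_exponent diameter_cylinder)

section \<open>Null sets from weights on words\<close>

text \<open>
  The upper bound. A word \<open>w\<close> of length \<open>n\<close> is given the weight \<open>\<Prod>k<n. p (w k) k\<close>; the weights of
  all words of length \<open>n\<close> add up to at most 1. The cylinders of rank \<open>n\<close> whose \<open>t\<close>-th power of the
  length is at most \<open>c n\<close> times the weight therefore contribute at most \<open>c n\<close> to a covering. As the
  inequality holds eventually for every sequence in \<open>A\<close>, these cylinders of all ranks \<open>\<ge> N\<close> cover,
  at a total cost of at most a tail of the convergent series \<open>c\<close>. Since all ranks are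
  used at once, the rank from which the inequality holds may depend on the sequence.
\<close>

lemma hausdorff_measure_zero_of_weights:
  fixes p :: "nat \<Rightarrow> nat \<Rightarrow> real" and c :: "nat \<Rightarrow> real"
  assumes V: "V \<subseteq> {..<s}" and t: "0 < t"
    and p0: "\<And>i k. i \<in> V \<Longrightarrow> 0 \<le> p i k" and p1: "\<And>k. (\<Sum>i\<in>V. p i k) \<le> 1"
    and c: "summable c" "\<And>n. 0 \<le> c n"
    and A: "\<And>a k. a \<in> A \<Longrightarrow> a k \<in> V"
    and small: "\<And>a. a \<in> A \<Longrightarrow>
      \<forall>\<^sub>F n in sequentially. cyl_length q a n powr t \<le> c n * (\<Prod>k<n. p (a k) k)"
  shows "hausdorff_measure t (Q_point q ` A) = 0"
proof -
  have *: "hausdorff_premeasure t \<epsilon> (Q_point q ` A) \<le> ennreal e" if "0 < \<epsilon>" "0 < e" for \<epsilon> e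
  proof -
    obtain N1 where N1: "\<And>n a. n \<ge> N1 \<Longrightarrow> (\<forall>k<n. a k < s) \<Longrightarrow> cyl_length q a n \<le> \<epsilon>"
      using eventually_cyl_length_le[OF \<open>0 < \<epsilon>\<close>] unfolding eventually_sequentially by blast
    obtain N2 where N2: "\<And>n. n \<ge> N2 \<Longrightarrow> norm (\<Sum>i. c (i + n)) < e"
      using suminf_exist_split[OF \<open>0 < e\<close> c(1)] by blast
    define N where "N = max N1 N2"
    define word where "word n = (\<Pi>\<^sub>E k\<in>{..<n}. V)" for n :: nat
    define I where "I n = {w \<in> word (n + N). cyl_length q w (n + N) powr t
        \<le> c (n + N) * (\<Prod>k<n + N. p (w k) k)}" for n
    have finV: "finite V" using V finite_subset by blast
    have fin_word: "finite (word n)" for n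
      unfolding word_def using finV by (intro finite_PiE) auto
    have word_s: "w k < s" if "w \<in> word n" "k < n" for w n k
      using that V by (auto simp: word_def)
    have I_s: "w k < s" if "w \<in> I n" "k < n + N" for w n k
      using that word_s by (auto simp: I_def)
    have "hausdorff_premeasure t \<epsilon> (Q_point q ` A)
        \<le> (\<Sum>n. \<Sum>w\<in>I n. diam_pow t (cylinder q w (n + N)))"
    proof (rule hausdorff_premeasure_le_finite_families)
      show "finite (I n)" for n using fin_word by (simp add: I_def)
      show "Q_point q ` A \<subseteq> (\<Union>n. \<Union>w\<in>I n. cylinder q w (n + N))"
      proof safe
        fix a assume a: "a \<in> A"
        obtain n0 where n0: "\<And>n. n \<ge> n0 \<Longrightarrow> cyl_length q a n powr t \<le> c n * (\<Prod>k<n. p (a k) k)"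
          using small[OF a] unfolding eventually_sequentially by blast
        define w where "w = restrict a {..<n0 + N}"
        have agree: "w k = a k" if "k < n0 + N" for k using that by (simp add: w_def)
        have "w \<in> I n0"
          using n0[of "n0 + N"] A[OF a] agree cyl_length_cong[of "n0 + N" w a q]
          by (auto simp: I_def word_def w_def)
        moreover have "Q_point q a \<in> cylinder q a (n0 + N)"
          using A[OF a] V by (intro Q_point_in_cylinder) blast
        then have "Q_point q a \<in> cylinder q w (n0 + N)"
          using cylinder_cong[of "n0 + N" w a q] agree by simp
        ultimately show "Q_point q a \<in> (\<Union>n. \<Union>w\<in>I n. cylinder q w (n + N))" by blast
      qed
      show "bounded (cylinder q w (n + N))" for w n
        by (simp add: cylinder_def)
      show "diameter (cylinder q w (n + N)) \<le> \<epsilon>" if "w \<in> I n" for w n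
        using diameter_cylinder[of "n + N" w] N1[of "n + N" w] I_s[OF that]
        by (simp add: N_def)
    qed (use \<open>0 < \<epsilon>\<close> in simp)
    also have "\<dots> \<le> (\<Sum>n. ennreal (c (n + N)))"
    proof (intro suminf_le summableI)
      fix n
      have "(\<Sum>w\<in>I n. diam_pow t (cylinder q w (n + N)))
          = (\<Sum>w\<in>I n. ennreal (cyl_length q w (n + N) powr t))"
        using diam_pow_cylinder[OF t] I_s by (intro sum.cong) auto
      also have "\<dots> = ennreal (\<Sum>w\<in>I n. cyl_length q w (n + N) powr t)"
        by (intro sum_ennreal) auto
      also have "(\<Sum>w\<in>I n. cyl_length q w (n + N) powr t)
          \<le> (\<Sum>w\<in>I n. c (n + N) * (\<Prod>k<n + N. p (w k) k))"
        by (intro sum_mono) (auto simp: I_def)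
      also have "\<dots> \<le> (\<Sum>w\<in>word (n + N). c (n + N) * (\<Prod>k<n + N. p (w k) k))"
        using fin_word c(2)
        by (intro sum_mono2)
          (auto simp: I_def word_def intro!: mult_nonneg_nonneg prod_nonneg p0)
      also have "\<dots> = c (n + N) * (\<Prod>k<n + N. \<Sum>i\<in>V. p i k)"
        using prod_sum_PiE[of "{..<n + N}" "\<lambda>_. V" "\<lambda>k i. p i k"] finV
        by (simp add: word_def sum_distrib_left)
      also have "\<dots> \<le> c (n + N) * 1"
        using c(2) p0 p1 by (intro mult_left_mono prod_le_1) (auto intro!: sum_nonneg)
      finally show "(\<Sum>w\<in>I n. diam_pow t (cylinder q w (n + N))) \<le> ennreal (c (n + N))"
        by (simp add: ennreal_leI)
    qed
    also have "\<dots> = ennreal (\<Sum>n. c (n + N))"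
      using c by (intro suminf_ennreal2) (simp_all add: summable_iff_shift)
    also have "\<dots> \<le> ennreal e"
      using N2[of N] by (intro ennreal_leI) (simp add: N_def)
    finally show ?thesis .
  qed
  have "hausdorff_premeasure t \<epsilon> (Q_point q ` A) \<le> 0" if "0 < \<epsilon>" for \<epsilon>
  proof (rule ennreal_le_epsilon)
    fix e :: real assume "0 < e"
    then show "hausdorff_premeasure t \<epsilon> (Q_point q ` A) \<le> 0 + ennreal e"
      using * that by simp
  qed
  then have "hausdorff_measure t (Q_point q ` A) \<le> 0"
    unfolding hausdorff_measure_def by (intro SUP_least) auto
  then show ?thesis by simp
qed

end

section \<open>Positive measure from product measures on sequences\<close>

context Q_tilde
begin

text \<open>
  Following each sequence up to the first rank at which its cylinder has length at most \<open>r\<close> gives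
  cylinders of length between \<open>b * r\<close> and \<open>r\<close>. Those that meet a set of diameter at most \<open>r\<close> have
  their left endpoints in an interval of length \<open>3 * r\<close>, and the left endpoints of distinct ones are
  at least \<open>b * r\<close> apart, so their number is bounded independently of \<open>r\<close>. The cylinder
  of rank 0 has length 1, so \<open>r < 1\<close> makes the stopping rank positive and gives the lower bound for
  the length.
\<close>

lemma few_stopped_cylinders_meet:
  fixes U :: "real set"
  assumes V: "V \<subseteq> {..<s}" and b: "0 < b" "\<And>i k. i \<in> V \<Longrightarrow> b \<le> q i k"
    and r: "0 < r" "r < 1" and U: "bounded U" "diameter U \<le> r"
    and range: "\<And>a. a \<in> A \<Longrightarrow> range a \<subseteq> V" and A_U: "\<And>a. a \<in> A \<Longrightarrow> Q_point q a \<in> U"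
  obtains Z m where "finite Z" "Z \<subseteq> A" "real (card Z) \<le> 3 / b + 2"
    and "\<And>z. z \<in> Z \<Longrightarrow> cyl_length q z (m z) \<le> r"
    and "\<And>a. a \<in> A \<Longrightarrow> \<exists>z\<in>Z. \<forall>k<m z. a k = z k"
proof (cases "A = {}")
  case True
  then show ?thesis using that[of "{}"] b by simp
next
  case False
  then obtain a0 where a0: "a0 \<in> A" by blast
  have A: "a k \<in> V" if "a \<in> A" for a k using range[OF that] by blast
  have As: "a k < s" if "a \<in> A" for a k using A[OF that] V by blast
  define \<tau> where "\<tau> a = (LEAST n. cyl_length q a n \<le> r)" for a
  define y where "y a = cyl_left q a (\<tau> a)" for a
  \<comment> \<open>equal values of \<open>g\<close> force left endpoints closer than \<open>b * r\<close>, hence the same stopped cylinder\<close>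
  define g where "g a = \<lfloor>(y a - Q_point q a0) / (b * r)\<rfloor>" for a
  have \<tau>: "cyl_length q a (\<tau> a) \<le> r" "b * r \<le> cyl_length q a (\<tau> a)" if a: "a \<in> A" for a
  proof -
    obtain n where "cyl_length q a n \<le> r"
      using eventually_cyl_length_le[OF r(1)] As[OF a] unfolding eventually_sequentially by blast
    then show le: "cyl_length q a (\<tau> a) \<le> r" unfolding \<tau>_def by (rule LeastI)
    then have "\<tau> a \<noteq> 0" using r(2) by (metis cyl_length_0 not_le)
    then obtain n where n: "\<tau> a = Suc n" using not0_implies_Suc by blast
    then have "r < cyl_length q a n"
      using not_less_Least[of n "\<lambda>n. cyl_length q a n \<le> r"] by (auto simp: \<tau>_def)
    moreover have "b \<le> q (a n) n" using b(2) A[OF a] by blast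
    ultimately show "b * r \<le> cyl_length q a (\<tau> a)"
      unfolding n cyl_length_Suc using b(1) r by (intro mult_mono) auto
  qed
  have y_range: "\<lfloor>- (2 / b)\<rfloor> \<le> g a" "g a \<le> \<lfloor>1 / b\<rfloor>" if a: "a \<in> A" for a
  proof -
    have "dist (Q_point q a) (Q_point q a0) \<le> r"
      using diameter_bounded_bound[OF U(1) A_U[OF a] A_U[OF a0]] U(2) by simp
    moreover have "Q_point q a \<in> cylinder q a (\<tau> a)"
      using As[OF a] by (intro Q_point_in_cylinder)
    ultimately have "- (2 * r) \<le> y a - Q_point q a0" "y a - Q_point q a0 \<le> r"
      using \<tau>(1)[OF a] by (auto simp: cylinder_def y_def dist_real_def)
    then have "- 2 \<le> (y a - Q_point q a0) / r" "(y a - Q_point q a0) / r \<le> 1"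
      using r(1) by (simp_all add: field_simps)
    then have "- 2 / b \<le> (y a - Q_point q a0) / r / b" "(y a - Q_point q a0) / r / b \<le> 1 / b"
      using b(1) by (intro divide_right_mono; simp)+
    then have "- (2 / b) \<le> (y a - Q_point q a0) / (b * r)"
      "(y a - Q_point q a0) / (b * r) \<le> 1 / b"
      by (simp_all add: mult.commute)
    then show "\<lfloor>- (2 / b)\<rfloor> \<le> g a" "g a \<le> \<lfloor>1 / b\<rfloor>"
      unfolding g_def by (simp_all only: floor_mono)
  qed
  have same: "\<forall>k<\<tau> z. a k = z k" if a: "a \<in> A" and z: "z \<in> A" and eq: "g a = g z" for a z
  proof (rule ccontr)
    assume "\<not> (\<forall>k<\<tau> z. a k = z k)"
    then obtain k0 where "k0 < \<tau> z \<and> a k0 \<noteq> z k0" by blast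
    then obtain k where k: "k < \<tau> z" "a k \<noteq> z k" and agree: "\<And>j. j < k \<Longrightarrow> a j = z j"
      using exists_least_iff[of "\<lambda>k. k < \<tau> z \<and> a k \<noteq> z k"] by (metis less_trans)
    \<comment> \<open>otherwise \<open>z\<close> would already have been stopped at the rank \<open>\<tau> a\<close>\<close>
    have k': "k < \<tau> a"
    proof (rule ccontr)
      assume "\<not> k < \<tau> a"
      then have "cyl_length q z (\<tau> a) \<le> r"
        using cyl_length_cong[of "\<tau> a" a z q] agree \<tau>(1)[OF a] by simp
      then have "\<tau> z \<le> \<tau> a" unfolding \<tau>_def[of z] by (rule Least_le)
      then show False using k \<open>\<not> k < \<tau> a\<close> by simp
    qed
    have apart: "g x \<noteq> g x'" if "b * r \<le> y x' - y x" for x x'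
    proof -
      have "(y x - Q_point q a0) / (b * r) + 1 \<le> (y x' - Q_point q a0) / (b * r)"
        using divide_right_mono[of "y x - Q_point q a0 + b * r" "y x' - Q_point q a0" "b * r"]
          that b(1) r(1) by (simp add: add_divide_distrib)
      then have "g x + 1 \<le> g x'" unfolding g_def by linarith
      then show ?thesis by simp
    qed
    show False
    proof (cases "a k < z k")
      case True
      then have "y a + cyl_length q a (\<tau> a) \<le> y z"
        unfolding y_def using cylinders_ordered[of a z k] As a z agree k k' by simp
      then show False using apart[of z a] \<tau>(2)[OF a] eq by simp
    next
      case False
      then have "y z + cyl_length q z (\<tau> z) \<le> y a"
        unfolding y_def using cylinders_ordered[of z a k] As a z agree k k' by simp
      then show False using apart[of a z] \<tau>(2)[OF z] eq by simp
    qed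
  qed
  have sub: "g ` A \<subseteq> {\<lfloor>- (2 / b)\<rfloor>..\<lfloor>1 / b\<rfloor>}" using y_range by auto
  then have fin: "finite (g ` A)" using finite_subset by blast
  define Z where "Z = inv_into A g ` g ` A"
  show ?thesis
  proof (rule that[of Z \<tau>])
    show "finite Z" using fin by (simp add: Z_def)
    show ZA: "Z \<subseteq> A" unfolding Z_def by (auto intro: inv_into_into)
    have "card Z \<le> card (g ` A)" unfolding Z_def by (rule card_image_le[OF fin])
    also have "\<dots> \<le> card {\<lfloor>- (2 / b)\<rfloor>..\<lfloor>1 / b\<rfloor>}" using sub by (intro card_mono) auto
    also have "real \<dots> \<le> 3 / b + 2"
    proof -
      have "\<lfloor>- (2 / b)\<rfloor> \<le> \<lfloor>1 / b\<rfloor>" using b(1) by (intro floor_mono order_trans[of "- (2 / b)" 0 "1 / b"]) auto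
      then have "real (card {\<lfloor>- (2 / b)\<rfloor>..\<lfloor>1 / b\<rfloor>})
          = of_int \<lfloor>1 / b\<rfloor> - of_int \<lfloor>- (2 / b)\<rfloor> + 1" by simp
      also have "\<dots> \<le> 1 / b - (- (2 / b) - 1) + 1" by linarith
      finally show ?thesis using b(1) by (simp add: field_simps)
    qed
    finally show "real (card Z) \<le> 3 / b + 2" by simp
    show "cyl_length q z (\<tau> z) \<le> r" if "z \<in> Z" for z using \<tau>(1) ZA that by blast
    show "\<exists>z\<in>Z. \<forall>k<\<tau> z. a k = z k" if a: "a \<in> A" for a
    proof -
      have "inv_into A g (g a) \<in> Z" "g (inv_into A g (g a)) = g a"
        using a by (auto simp: Z_def f_inv_into_f)
      then show ?thesis using same[OF a, of "inv_into A g (g a)"] ZA by auto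
    qed
  qed
qed

end

lemma emeasure_PiM_pmf_prefix:
  fixes P :: "nat \<Rightarrow> 'a pmf"
  defines "M \<equiv> PiM UNIV (\<lambda>k. measure_pmf (P k))"
  shows "{a. \<forall>k<n. a k = z k} \<in> sets M"
    and "emeasure M {a. \<forall>k<n. a k = z k} = ennreal (\<Prod>k<n. pmf (P k) (z k))"
proof -
  let ?E = "prod_emb UNIV (\<lambda>k. measure_pmf (P k)) {..<n} (\<Pi>\<^sub>E k\<in>{..<n}. {z k})"
  have eq: "{a. \<forall>k<n. a k = z k} = ?E"
    by (rule set_eqI) (simp add: prod_emb_iff Pi_iff Ball_def)
  show "{a. \<forall>k<n. a k = z k} \<in> sets M"
    unfolding eq M_def by (rule sets_PiM_I) simp_all
  have "emeasure M ?E = (\<Prod>k<n. emeasure (measure_pmf (P k)) {z k})"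
    unfolding M_def by (rule emeasure_PiM_emb) (simp_all add: prob_space_measure_pmf)
  also have "\<dots> = ennreal (\<Prod>k<n. pmf (P k) (z k))"
    by (simp add: emeasure_pmf_single prod_ennreal)
  finally show "emeasure M {a. \<forall>k<n. a k = z k} = ennreal (\<Prod>k<n. pmf (P k) (z k))"
    unfolding eq .
qed

lemma space_PiM_pmf: "space (PiM UNIV (\<lambda>k. measure_pmf (P k))) = UNIV"
  by (simp add: space_PiM PiE_UNIV_domain)

context Q_tilde
begin

text \<open>
  The lower bound, a form of the mass distribution principle. A set of diameter at most \<open>r\<close> meets at
  most \<open>3 / b + 2\<close> stopped cylinders, each of mass at most \<open>C * r powr t\<close>, so a covering of \<open>A\<close> costs
  at least a fixed multiple of the mass that it captures. The constant \<open>C\<close> may depend on the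
  sequence: by countable additivity some value of \<open>C\<close> is valid on a set of positive mass.
\<close>

lemma hausdorff_measure_pos_of_product_measure:
  fixes P :: "nat \<Rightarrow> nat pmf"
  defines "M \<equiv> PiM UNIV (\<lambda>k. measure_pmf (P k))"
  assumes V: "V \<subseteq> {..<s}" and b: "0 < b" "\<And>i k. i \<in> V \<Longrightarrow> b \<le> q i k" and t: "0 < t"
    and ae: "AE a in M. a \<in> A \<and> (\<forall>k. a k \<in> V) \<and>
      (\<exists>C::nat. \<forall>n. (\<Prod>k<n. pmf (P k) (a k)) \<le> real C * cyl_length q a n powr t)"
  shows "hausdorff_measure t (Q_point q ` A) \<noteq> 0"
proof
  assume zero: "hausdorff_measure t (Q_point q ` A) = 0"
  have "prob_space M"
    unfolding M_def by (rule prob_space_PiM) (rule prob_space_measure_pmf)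
  then interpret prob_space M .
  have [simp]: "space M = UNIV" unfolding M_def by (rule space_PiM_pmf)
  have comp [measurable]: "(\<lambda>a. a k) \<in> measurable M (count_space UNIV)" for k
    using measurable_component_singleton[of k UNIV "\<lambda>k. measure_pmf (P k)"]
    by (simp add: M_def)
  have comp_real: "(\<lambda>a. f (a k)) \<in> borel_measurable M" for f :: "nat \<Rightarrow> real" and k
    by (rule measurable_compose[OF comp]) simp
  define B where "B C = {a. \<forall>n. (\<Prod>k<n. pmf (P k) (a k)) \<le> real C * cyl_length q a n powr t}"
    for C :: nat
  have Bm: "B C \<in> sets M" for C
  proof -
    have "(\<lambda>a. \<Prod>k<n. pmf (P k) (a k)) \<in> borel_measurable M"
      "(\<lambda>a. cyl_length q a n) \<in> borel_measurable M" for n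
      unfolding cyl_length_def
      using comp_real[of "pmf (P _)"] comp_real[of "\<lambda>i. q i _"]
      by (auto intro!: borel_measurable_prod)
    then have "{a \<in> space M. (\<Prod>k<n. pmf (P k) (a k)) \<le> real C * cyl_length q a n powr t} \<in> sets M" for n
      by (intro borel_measurable_le borel_measurable_times powr_real_measurable) auto
    then have "{a \<in> space M. \<forall>n. (\<Prod>k<n. pmf (P k) (a k)) \<le> real C * cyl_length q a n powr t} \<in> sets M"
      by (rule sets.sets_Collect_countable_All)
    then show ?thesis by (simp add: B_def)
  qed
  obtain N where N: "{a \<in> space M. \<not> (a \<in> A \<and> (\<forall>k. a k \<in> V) \<and>
      (\<exists>C::nat. \<forall>n. (\<Prod>k<n. pmf (P k) (a k)) \<le> real C * cyl_length q a n powr t))} \<subseteq> N"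
    and N0: "emeasure M N = 0" "N \<in> sets M"
    using ae by (rule AE_E)
  have good: "a \<in> A" "a k \<in> V" "\<exists>C. a \<in> B C" if "a \<notin> N" for a k
  proof -
    have "a \<in> A \<and> (\<forall>k. a k \<in> V) \<and>
        (\<exists>C::nat. \<forall>n. (\<Prod>k<n. pmf (P k) (a k)) \<le> real C * cyl_length q a n powr t)"
      using subsetD[OF N, of a] that by (simp del: not_all not_ex) blast
    then show "a \<in> A" "a k \<in> V" "\<exists>C. a \<in> B C" by (auto simp: B_def)
  qed
  have Nn: "N \<in> null_sets M" using N0 by auto
  obtain C where C: "emeasure M (B C) \<noteq> 0"
  proof (rule ccontr)
    assume "\<not> thesis"
    then have "B C \<in> null_sets M" for C using that Bm by blast
    then have "N \<union> (\<Union>C. B C) \<in> null_sets M" using Nn by blast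
    moreover have "a \<in> N \<union> (\<Union>C. B C)" for a
      using good(3)[of a] by (cases "a \<in> N") auto
    then have "N \<union> (\<Union>C. B C) = space M" by auto
    ultimately show False using emeasure_space_1 by auto
  qed
  define S where "S = B C - N"
  have S: "emeasure M S = emeasure M (B C)" "S \<in> sets M"
    unfolding S_def using emeasure_Diff_null_set[OF Nn Bm] Bm N0 by auto
  define \<mu> where "\<mu> = measure M S"
  have \<mu>: "emeasure M S = ennreal \<mu>" "0 < \<mu>"
    using C S by (auto simp: \<mu>_def emeasure_eq_measure zero_less_measure_iff)
  define K where "K = (3 / b + 2) * (real C + 1)"
  have K: "0 < K" using b(1) by (simp add: K_def add_pos_nonneg)
  define \<delta> where "\<delta> = \<mu> / (4 * K)"
  have \<delta>: "0 < \<delta>" using \<mu> K by (simp add: \<delta>_def)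
  have "hausdorff_premeasure t (1/2) (Q_point q ` A) < ennreal \<delta>"
    using hausdorff_premeasure_le_measure[of "1/2" t "Q_point q ` A"] zero \<delta>
    by (simp add: le_zero_eq)
  then obtain U where U: "Q_point q ` A \<subseteq> (\<Union>n::nat. U n)" "\<And>n. bounded (U n)"
    "\<And>n. diameter (U n) \<le> 1/2" "(\<Sum>n. diam_pow t (U n)) < ennreal \<delta>"
    unfolding hausdorff_premeasure_def Inf_less_iff by blast
  \<comment> \<open>a covering set may be a single point; slightly larger positive radii keep the total cost small\<close>
  have "\<exists>r. 0 < r \<and> r < 1 \<and> diameter (U n) \<le> r \<and>
      r powr t \<le> diameter (U n) powr t + \<delta> * (1/2) ^ Suc n" for n
  proof -
    have d0: "0 \<le> diameter (U n)" using U(2) by (rule diameter_ge_0)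
    have "((\<lambda>r. r powr t) \<longlongrightarrow> diameter (U n) powr t) (at_right (diameter (U n)))"
      using t d0 by (intro tendsto_powr2 tendsto_ident_at tendsto_const)
        (auto simp: eventually_at_filter)
    then have "\<forall>\<^sub>F r in at_right (diameter (U n)). r powr t < diameter (U n) powr t + \<delta> * (1/2) ^ Suc n"
      using \<delta> by (intro order_tendstoD) auto
    moreover have "\<forall>\<^sub>F r in at_right (diameter (U n)). r \<in> {diameter (U n)<..<1}"
      using U(3)[of n] by (intro eventually_at_right_real) simp
    ultimately have "\<forall>\<^sub>F r in at_right (diameter (U n)). 0 < r \<and> r < 1 \<and> diameter (U n) \<le> r \<and>
      r powr t \<le> diameter (U n) powr t + \<delta> * (1/2) ^ Suc n"
      by eventually_elim (use d0 in auto)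
    then show ?thesis by (rule eventually_happens'[rotated]) simp
  qed
  then obtain r where r: "\<And>n. 0 < r n" "\<And>n. r n < 1" "\<And>n. diameter (U n) \<le> r n"
    and rt: "\<And>n. r n powr t \<le> diameter (U n) powr t + \<delta> * (1/2) ^ Suc n" by metis
  have "\<exists>D. D \<in> sets M \<and> {a\<in>S. Q_point q a \<in> U n} \<subseteq> D \<and> emeasure M D \<le> ennreal (K * r n powr t)" for n
  proof -
    have T: "range a \<subseteq> V" if "a \<in> {a\<in>S. Q_point q a \<in> U n}" for a
      using good that by (auto simp: S_def)
    have T': "Q_point q a \<in> U n" if "a \<in> {a\<in>S. Q_point q a \<in> U n}" for a
      using that by simp
    obtain Z m where Z: "finite Z" "Z \<subseteq> {a\<in>S. Q_point q a \<in> U n}" "real (card Z) \<le> 3 / b + 2"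
      and m: "\<And>z. z \<in> Z \<Longrightarrow> cyl_length q z (m z) \<le> r n"
      and cov: "\<And>a. a \<in> {a\<in>S. Q_point q a \<in> U n} \<Longrightarrow> \<exists>z\<in>Z. \<forall>k<m z. a k = z k"
      by (rule few_stopped_cylinders_meet[where A = "{a\<in>S. Q_point q a \<in> U n}" and U = "U n",
            OF V b r(1,2)[of n] U(2) r(3) T T'])
        (assumption | rule that)+
    define D where "D = (\<Union>z\<in>Z. {a. \<forall>k<m z. a k = z k})"
    have pre: "{a. \<forall>k<m z. a k = z k} \<in> sets M" for z
      unfolding M_def by (rule emeasure_PiM_pmf_prefix)
    have "emeasure M D \<le> (\<Sum>z\<in>Z. emeasure M {a. \<forall>k<m z. a k = z k})"
      unfolding D_def using Z(1) pre by (intro emeasure_subadditive_finite) auto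
    also have "\<dots> \<le> (\<Sum>z\<in>Z. ennreal ((real C + 1) * r n powr t))"
    proof (rule sum_mono)
      fix z assume z: "z \<in> Z"
      then have zS: "z \<in> S" using Z(2) by blast
      have pos: "0 < cyl_length q z (m z)"
        using good(2)[of z] zS V by (intro cyl_length_pos) (auto simp: S_def)
      have "(\<Prod>k<m z. pmf (P k) (z k)) \<le> real C * cyl_length q z (m z) powr t"
        using zS by (simp add: S_def B_def)
      also have "\<dots> \<le> (real C + 1) * r n powr t"
        using m[OF z] pos t by (intro mult_mono powr_mono2) auto
      finally show "emeasure M {a. \<forall>k<m z. a k = z k} \<le> ennreal ((real C + 1) * r n powr t)"
        unfolding M_def emeasure_PiM_pmf_prefix by (rule ennreal_leI)
    qed
    also have "\<dots> = ennreal (real (card Z) * ((real C + 1) * r n powr t))"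
      by (simp add: ennreal_mult ennreal_of_nat_eq_real_of_nat)
    also have "\<dots> \<le> ennreal (K * r n powr t)"
      unfolding K_def mult.assoc using Z(3) by (intro ennreal_leI mult_right_mono) auto
    finally have "emeasure M D \<le> ennreal (K * r n powr t)" .
    moreover have "D \<in> sets M" unfolding D_def using Z(1) pre by (intro sets.finite_UN) auto
    moreover have "{a\<in>S. Q_point q a \<in> U n} \<subseteq> D" using cov by (auto simp: D_def)
    ultimately show ?thesis by blast
  qed
  then obtain D where D: "\<And>n. D n \<in> sets M" "\<And>n. {a\<in>S. Q_point q a \<in> U n} \<subseteq> D n"
    "\<And>n. emeasure M (D n) \<le> ennreal (K * r n powr t)" by metis
  have "S \<subseteq> (\<Union>n. D n)"
  proof
    fix a assume a: "a \<in> S"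
    then have "Q_point q a \<in> Q_point q ` A" using good(1) by (simp add: S_def)
    then obtain n where "Q_point q a \<in> U n" using U(1) by blast
    then show "a \<in> (\<Union>n. D n)" using D(2)[of n] a by blast
  qed
  then have "ennreal \<mu> \<le> emeasure M (\<Union>n. D n)"
    unfolding \<mu>(1)[symmetric] using D(1) by (intro emeasure_mono) auto
  also have "\<dots> \<le> (\<Sum>n. emeasure M (D n))"
    using D(1) by (intro emeasure_subadditive_countably) auto
  also have "\<dots> \<le> (\<Sum>n. ennreal K * (diam_pow t (U n) + ennreal (\<delta> * (1/2) ^ Suc n)))"
  proof (intro suminf_le summableI)
    fix n
    have "emeasure M (D n) \<le> ennreal K * ennreal (r n powr t)"
      using D(3)[of n] K by (simp add: ennreal_mult)
    also have "ennreal (r n powr t) \<le> ennreal (diameter (U n) powr t + \<delta> * (1/2) ^ Suc n)"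
      using rt by (rule ennreal_leI)
    also have "\<dots> = diam_pow t (U n) + ennreal (\<delta> * (1/2) ^ Suc n)"
      using \<delta> by (simp add: diam_pow_pos_exponent[OF t])
    finally show "emeasure M (D n) \<le> ennreal K * (diam_pow t (U n) + ennreal (\<delta> * (1/2) ^ Suc n))"
      by (simp add: mult_left_mono)
  qed
  also have "\<dots> = ennreal K * ((\<Sum>n. diam_pow t (U n)) + (\<Sum>n. ennreal (\<delta> * (1/2) ^ Suc n)))"
    by (simp add: suminf_add[symmetric] del: power_Suc)
  also have "(\<Sum>n. ennreal (\<delta> * (1/2) ^ Suc n)) = ennreal \<delta>"
  proof -
    have "(\<lambda>n. \<delta> * (1/2) ^ Suc n) sums (\<delta> * 1)"
      by (intro sums_mult power_half_series)
    then show ?thesis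
      using \<delta> by (subst suminf_ennreal2) (auto simp: sums_iff simp del: power_Suc)
  qed
  also have "ennreal K * ((\<Sum>n. diam_pow t (U n)) + ennreal \<delta>) \<le> ennreal K * (ennreal \<delta> + ennreal \<delta>)"
    using U(4) by (intro mult_left_mono add_right_mono) auto
  also have "ennreal \<delta> + ennreal \<delta> = ennreal (\<delta> + \<delta>)"
    by (rule ennreal_plus[symmetric]) (use \<delta> in auto)
  also have "ennreal K * ennreal (\<delta> + \<delta>) = ennreal (K * (\<delta> + \<delta>))"
    by (rule ennreal_mult[symmetric]) (use K \<delta> in auto)
  also have "K * (\<delta> + \<delta>) = \<mu> / 2" using K by (simp add: \<delta>_def field_simps)
  finally have "\<mu> \<le> \<mu> / 2" by (subst (asm) ennreal_le_iff) (use \<mu>(2) in auto)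
  then show False using \<mu>(2) by simp
qed

end

section \<open>Sequences with prescribed frequencies\<close>

lemma sum_over_symbols:
  fixes f :: "nat \<Rightarrow> real"
  assumes "\<And>k. a k < s"
  shows "(\<Sum>k<n. f (a k)) = (\<Sum>i<s. real (symbol_count a i n) * f i)"
proof -
  have "(\<Sum>k<n. f (a k)) = (\<Sum>k<n. \<Sum>i<s. if a k = i then f i else 0)"
    using assms by (intro sum.cong) (auto simp: sum.delta')
  also have "\<dots> = (\<Sum>i<s. \<Sum>k<n. if a k = i then f i else 0)"
    by (rule sum.swap)
  also have "\<dots> = (\<Sum>i<s. real (symbol_count a i n) * f i)"
  proof (rule sum.cong[OF refl])
    fix i
    have "(\<Sum>k<n. if a k = i then f i else 0) = (\<Sum>k\<in>{k. k < n \<and> a k = i}. f i)"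
      by (subst sum.inter_filter[symmetric]) (auto intro!: sum.cong)
    then show "(\<Sum>k<n. if a k = i then f i else 0) = real (symbol_count a i n) * f i"
      by (simp add: symbol_count_def)
  qed
  finally show ?thesis .
qed

text \<open>
  Along a sequence with frequencies \<open>\<nu>\<close>, the averages of \<open>f\<close> tend to its \<open>\<nu>\<close>-mean. The
  hypothesis on \<open>g\<close> is one-sided, because in the application \<open>g\<close> involves \<open>ln (q i k)\<close>, which
  tends to \<open>-\<infinity>\<close> when the limit of \<open>q i\<close> is 0.
\<close>

lemma eventually_sum_along_frequencies_le:
  fixes f :: "nat \<Rightarrow> real" and g :: "nat \<Rightarrow> nat \<Rightarrow> real"
  assumes a: "\<And>k. a k < s"
    and freq: "\<And>i. i < s \<Longrightarrow> (\<lambda>n. real (symbol_count a i n) / real n) \<longlonglongrightarrow> \<nu> i"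
    and g: "\<And>i. i < s \<Longrightarrow> \<forall>\<^sub>F k in sequentially. g i k \<le> f i"
    and less: "(\<Sum>i<s. \<nu> i * f i) < \<gamma>"
  shows "\<forall>\<^sub>F n in sequentially. (\<Sum>k<n. g (a k) k) \<le> \<gamma> * real n"
proof -
  have "\<forall>\<^sub>F k in sequentially. \<forall>i\<in>{..<s}. g i k \<le> f i"
    using g by (intro eventually_ball_finite) auto
  then obtain N where N: "\<And>k i. k \<ge> N \<Longrightarrow> i < s \<Longrightarrow> g i k \<le> f i"
    unfolding eventually_sequentially by auto
  define K where "K = (\<Sum>k<N. \<bar>g (a k) k - f (a k)\<bar>)"
  \<comment> \<open>finitely many exceptional positions change the sum by a bounded amount\<close>
  have bound: "(\<Sum>k<n. g (a k) k) \<le> (\<Sum>k<n. f (a k)) + K" for n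
  proof -
    have "(\<Sum>k<n. g (a k) k) \<le> (\<Sum>k<n. f (a k) + (if k < N then \<bar>g (a k) k - f (a k)\<bar> else 0))"
      using N a by (intro sum_mono) (auto simp: not_less)
    also have "\<dots> = (\<Sum>k<n. f (a k)) + (\<Sum>k\<in>{k\<in>{..<n}. k < N}. \<bar>g (a k) k - f (a k)\<bar>)"
      by (simp only: sum.distrib sum.inter_filter[OF finite_lessThan])
    also have "(\<Sum>k\<in>{k\<in>{..<n}. k < N}. \<bar>g (a k) k - f (a k)\<bar>) \<le> K"
      unfolding K_def by (intro sum_mono2) auto
    finally show ?thesis by simp
  qed
  have "(\<lambda>n. (\<Sum>i<s. real (symbol_count a i n) / real n * f i) + K * (1 / real n))
      \<longlonglongrightarrow> (\<Sum>i<s. \<nu> i * f i) + K * 0"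
    using freq by (intro tendsto_intros lim_1_over_n) auto
  then have "\<forall>\<^sub>F n in sequentially.
      (\<Sum>i<s. real (symbol_count a i n) / real n * f i) + K * (1 / real n) < \<gamma>"
    using less by (intro order_tendstoD) auto
  then show ?thesis
    using eventually_gt_at_top[of 0]
  proof eventually_elim
    case (elim n)
    have "(\<Sum>i<s. real (symbol_count a i n) / real n * f i) + K * (1 / real n)
        = ((\<Sum>k<n. f (a k)) + K) / real n"
      unfolding sum_over_symbols[where a = a and f = f, OF a] by (simp add: sum_divide_distrib add_divide_distrib)
    then have "(\<Sum>k<n. f (a k)) + K < \<gamma> * real n"
      using elim by (simp add: divide_less_eq)
    then show ?case using bound[of n] by linarith
  qed
qed

lemma eventually_le_imp_nat_bound:
  fixes R :: "nat \<Rightarrow> real"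
  assumes "\<forall>\<^sub>F n in sequentially. R n \<le> K"
  shows "\<exists>C::nat. \<forall>n. R n \<le> real C"
proof -
  obtain N where N: "\<And>n. n \<ge> N \<Longrightarrow> R n \<le> K"
    using assms unfolding eventually_sequentially by blast
  define B where "B = \<bar>K\<bar> + (\<Sum>n<N. \<bar>R n\<bar>)"
  have "R n \<le> B" for n
  proof (cases "n < N")
    case True
    then have "\<bar>R n\<bar> \<le> (\<Sum>n<N. \<bar>R n\<bar>)"
      by (intro member_le_sum[of n "{..<N}" "\<lambda>n. \<bar>R n\<bar>"]) auto
    then show ?thesis unfolding B_def by linarith
  next
    case False
    moreover have "0 \<le> (\<Sum>n<N. \<bar>R n\<bar>)" by (intro sum_nonneg) auto
    ultimately show ?thesis unfolding B_def using N[of n] by linarith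
  qed
  moreover have "B \<le> real (nat \<lceil>B\<rceil>)" by (rule real_nat_ceiling_ge)
  ultimately show ?thesis by (meson order_trans)
qed

lemma sequence_pos_lower_bound:
  fixes f :: "nat \<Rightarrow> real"
  assumes "\<And>k. 0 < f k" "f \<longlonglongrightarrow> l" "0 < l"
  shows "\<exists>b>0. \<forall>k. b \<le> f k"
proof -
  have "\<forall>\<^sub>F k in sequentially. 1 / f k \<le> 2 / l"
    using order_tendstoD(1)[OF assms(2), of "l / 2"] assms(3)
    by (auto elim!: eventually_mono simp: field_simps)
  then obtain C :: nat where C: "\<And>k. 1 / f k \<le> real C"
    using eventually_le_imp_nat_bound[of "\<lambda>k. 1 / f k"] by blast
  have "1 / (real C + 1) \<le> f k" for k
    using C[of k] assms(1)[of k] by (simp add: field_simps)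
  then show ?thesis by (intro exI[of _ "1 / (real C + 1)"]) auto
qed

lemma uniform_pos_lower_bound:
  fixes q :: "'i \<Rightarrow> nat \<Rightarrow> real"
  assumes "finite V" "\<And>i k. i \<in> V \<Longrightarrow> 0 < q i k" "\<And>i. i \<in> V \<Longrightarrow> (q i) \<longlonglongrightarrow> l i"
    "\<And>i. i \<in> V \<Longrightarrow> 0 < l i"
  shows "\<exists>b>0. \<forall>i\<in>V. \<forall>k. b \<le> q i k"
proof -
  have "\<exists>b>0. \<forall>k. b \<le> q i k" if "i \<in> V" for i
    using sequence_pos_lower_bound assms(2-4) that by blast
  then obtain b where b: "\<And>i. i \<in> V \<Longrightarrow> 0 < b i" "\<And>i k. i \<in> V \<Longrightarrow> b i \<le> q i k" by metis
  have "0 < Min (insert 1 (b ` V))" using assms(1) b by (subst Min_gr_iff) auto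
  moreover have "Min (insert 1 (b ` V)) \<le> q i k" if "i \<in> V" for i k
    using assms(1) that b(2)[OF that] by (intro order_trans[OF Min_le[of _ "b i"]]) auto
  ultimately show ?thesis by blast
qed

lemma finite_pmf_exists:
  fixes p :: "'i \<Rightarrow> real"
  assumes "finite V" "\<And>i. i \<in> V \<Longrightarrow> 0 \<le> p i" "(\<Sum>i\<in>V. p i) = 1"
  shows "\<exists>P. \<forall>i. pmf P i = (if i \<in> V then p i else 0)"
proof -
  let ?f = "\<lambda>i. if i \<in> V then p i else 0"
  have nonneg: "0 \<le> ?f i" for i using assms(2) by simp
  have "(\<integral>\<^sup>+ i. ennreal (?f i) \<partial>count_space UNIV) = (\<Sum>i\<in>V. ennreal (?f i))"
    using assms(1) by (intro nn_integral_count_space') auto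
  also have "\<dots> = 1"
    using assms by (subst sum_ennreal) auto
  finally have "pmf (embed_pmf ?f) i = ?f i" for i
    using nonneg by (intro pmf_embed_pmf) auto
  then show ?thesis by blast
qed

lemma AE_PiM_pmf_in:
  fixes P :: "nat \<Rightarrow> 'a pmf"
  assumes "\<And>k. set_pmf (P k) \<subseteq> V"
  shows "AE a in PiM UNIV (\<lambda>k. measure_pmf (P k)). \<forall>k. a k \<in> V"
proof (subst AE_all_countable, rule allI)
  fix k
  have "AE x in measure_pmf (P k). x \<in> V"
    using assms by (auto simp: AE_measure_pmf_iff)
  then show "AE a in PiM UNIV (\<lambda>k. measure_pmf (P k)). a k \<in> V"
    by (intro AE_PiM_component) (auto intro: prob_space_measure_pmf)
qed

text \<open>
  The strong law of large numbers for the indicator of one symbol: Hoeffding's inequality makes the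
  probabilities of a deviation by \<open>\<epsilon>\<close> summable, and the Borel-Cantelli lemma applies.
\<close>

lemma AE_symbol_frequency:
  fixes P :: "nat pmf"
  shows "AE a in PiM UNIV (\<lambda>_. measure_pmf P).
    (\<lambda>n. real (symbol_count a i n) / real n) \<longlonglongrightarrow> pmf P i"
proof -
  define M where "M = PiM (UNIV :: nat set) (\<lambda>_. measure_pmf P)"
  have "prob_space M"
    unfolding M_def by (rule prob_space_PiM) (rule prob_space_measure_pmf)
  then interpret prob_space M .
  have [simp]: "space M = UNIV" unfolding M_def by (rule space_PiM_pmf)
  have comp: "(\<lambda>a. a k) \<in> measurable M (measure_pmf P)" for k
    unfolding M_def by (rule measurable_component_singleton) simp
  have distr_comp: "distr M (measure_pmf P) (\<lambda>a. a k) = measure_pmf P" for k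
    unfolding M_def by (rule distr_PiM_component) (auto intro: prob_space_measure_pmf)
  define X where "X k a = indicat_real {i} (a k)" for k :: nat and a :: "nat \<Rightarrow> nat"
  have indep: "indep_vars (\<lambda>_. measure_pmf P) (\<lambda>k a. a k) UNIV"
    unfolding indep_vars_iff_distr_eq_PiM'[OF UNIV_not_empty comp] distr_comp
    by (simp add: M_def[symmetric] restrict_def distr_id2)
  have indep_X: "indep_vars (\<lambda>_. borel) X UNIV"
    unfolding X_def by (rule indep_vars_compose2[OF indep]) simp
  have rv: "X k \<in> borel_measurable M" for k
    using indep_X unfolding indep_vars_def by auto
  have distr_X: "distr M borel (X k) = distr (measure_pmf P) borel (indicat_real {i})" for k
  proof -
    have "distr M borel (X k) = distr (distr M (measure_pmf P) (\<lambda>a. a k)) borel (indicat_real {i})"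
      using comp[of k] by (subst distr_distr) (auto simp: X_def[abs_def] comp_def)
    then show ?thesis by (simp add: distr_comp)
  qed
  have mean: "expectation (X 0) = pmf P i"
  proof -
    have "expectation (X 0) = (\<integral>x. x \<partial>distr M borel (X 0))"
      using rv by (subst integral_distr) auto
    also have "\<dots> = (\<integral>x. indicat_real {i} x \<partial>measure_pmf P)"
      unfolding distr_X by (subst integral_distr) auto
    also have "\<dots> = pmf P i" by (simp add: measure_pmf_single)
    finally show ?thesis .
  qed
  have count: "(\<Sum>k<n. X k a) = real (symbol_count a i n)" for a n
  proof -
    have "(\<Sum>k<n. X k a) = (\<Sum>k<n. if a k = i then 1 else 0)"
      by (intro sum.cong) (auto simp: X_def)
    also have "\<dots> = (\<Sum>k\<in>{k. k < n \<and> a k = i}. 1)"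
      by (subst sum.inter_filter[symmetric]) (auto intro!: sum.cong)
    finally show ?thesis by (simp add: symbol_count_def)
  qed
  have far: "AE a in M. \<forall>\<^sub>F n in sequentially. \<bar>real (symbol_count a i n) / real n - pmf P i\<bar> < \<epsilon>"
    if "0 < \<epsilon>" for \<epsilon>
  proof -
    define B where "B n = {a \<in> space M. \<bar>real (symbol_count a i n) / real n - pmf P i\<bar> \<ge> \<epsilon>}" for n
    have Bm: "B n \<in> sets M" for n
    proof -
      have "(\<lambda>a. \<bar>(\<Sum>k<n. X k a) / real n - pmf P i\<bar>) \<in> borel_measurable M"
        using rv by (intro borel_measurable_abs borel_measurable_diff borel_measurable_divide
            borel_measurable_sum) auto
      then show ?thesis
        unfolding B_def count[symmetric] by (intro borel_measurable_le borel_measurable_const)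
    qed
    have le: "measure M (B n) \<le> 2 * exp (- (2 * \<epsilon>\<^sup>2)) ^ n" if "1 \<le> n" for n
    proof -
      interpret Hoeffding_ineq_iid M "{..<n}" X "X 0" 0 1 "pmf P i"
      proof unfold_locales
        show "indep_vars (\<lambda>_. borel) X {..<n}"
          using indep_X by (rule indep_vars_subset) simp
        show "pmf P i \<equiv> expectation (X 0)" using mean by simp
      qed (use rv distr_X in \<open>auto simp: X_def indicator_def\<close>)
      have "{..<n} \<noteq> {}" using that by (auto simp: lessThan_empty_iff)
      then have "measure M (B n) \<le> 2 * exp (- 2 * real (card {..<n}) * \<epsilon>\<^sup>2 / (1 - 0)\<^sup>2)"
        unfolding B_def count[symmetric]
        using Hoeffding_ineq_abs_ge'[of \<epsilon>] \<open>0 < \<epsilon>\<close> by simp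
      also have "\<dots> = 2 * exp (- (2 * \<epsilon>\<^sup>2)) ^ n"
        by (simp add: exp_of_nat_mult[symmetric] mult_ac)
      finally show ?thesis .
    qed
    have "AE a in M. \<forall>\<^sub>F n in sequentially. a \<in> space M - B n"
    proof (rule borel_cantelli_AE1[OF Bm])
      show "summable (\<lambda>n. measure M (B n))"
      proof (rule summable_comparison_test)
        show "\<exists>N. \<forall>n\<ge>N. norm (measure M (B n)) \<le> 2 * exp (- (2 * \<epsilon>\<^sup>2)) ^ n"
          using le by (intro exI[of _ 1]) auto
        show "summable (\<lambda>n. 2 * exp (- (2 * \<epsilon>\<^sup>2)) ^ n)"
          using \<open>0 < \<epsilon>\<close> by (intro summable_mult summable_geometric) simp
      qed
    qed (simp add: emeasure_eq_measure)
    then show ?thesis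
      by eventually_elim (auto elim!: eventually_mono simp: B_def not_le)
  qed
  have "AE a in M. \<forall>m::nat. \<forall>\<^sub>F n in sequentially.
      \<bar>real (symbol_count a i n) / real n - pmf P i\<bar> < 1 / real (Suc m)"
    by (subst AE_all_countable) (auto intro!: far simp del: of_nat_Suc)
  then have "AE a in M. (\<lambda>n. real (symbol_count a i n) / real n) \<longlonglongrightarrow> pmf P i"
  proof eventually_elim
    case (elim a)
    show ?case
    proof (rule tendstoI)
      fix e :: real assume "0 < e"
      then obtain m where m: "1 / real (Suc m) < e" using nat_approx_posE by blast
      show "\<forall>\<^sub>F n in sequentially. dist (real (symbol_count a i n) / real n) (pmf P i) < e"
        using elim[rule_format, of m] by eventually_elim (use m in \<open>simp add: dist_real_def\<close>)
    qed
  qed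
  then show ?thesis unfolding M_def .
qed

section \<open>The equation for the dimension\<close>

lemma sum_powr_strict_antimono:
  fixes c :: "'i \<Rightarrow> real"
  assumes V: "finite V" "\<And>i. i \<in> V \<Longrightarrow> 0 \<le> c i" "\<And>i. i \<in> V \<Longrightarrow> c i < 1" "\<exists>i\<in>V. 0 < c i"
    and "x < y"
  shows "(\<Sum>i\<in>V. c i powr y) < (\<Sum>i\<in>V. c i powr x)"
proof (rule sum_strict_mono_ex1)
  have less: "c i powr y < c i powr x" if "i \<in> V" "0 < c i" for i
    using V(3)[OF that(1)] that(2) \<open>x < y\<close> by (simp add: powr_less_cancel_iff powr_def)
  then show "\<forall>i\<in>V. c i powr y \<le> c i powr x"
    using V(2) by (metis less_eq_real_def powr_0)
  show "\<exists>i\<in>V. c i powr y < c i powr x" using less V(4) by blast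
qed (rule V(1))

lemma sum_powr_eq_1_root_exists:
  fixes c :: "'i \<Rightarrow> real"
  assumes V: "finite V" "\<And>i. i \<in> V \<Longrightarrow> 0 \<le> c i" "\<exists>i\<in>V. 0 < c i" and "(\<Sum>i\<in>V. c i) \<le> 1"
  shows "\<exists>x\<ge>0. (\<Sum>i\<in>V. c i powr x) = 1"
proof -
  have "continuous_on {0..1} (\<lambda>x. c i powr x)" for i
    by (cases "c i = 0") (auto intro!: continuous_intros)
  then have cont: "continuous_on {0..1} (\<lambda>x. \<Sum>i\<in>V. c i powr x)"
    by (intro continuous_on_sum)
  have "(\<Sum>i\<in>V. c i powr 1) \<le> 1" using assms by (simp add: powr_one)
  moreover have "1 \<le> (\<Sum>i\<in>V. c i powr 0)"
  proof -
    obtain i where i: "i \<in> V" "0 < c i" using V(3) by blast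
    then have "c i powr 0 \<le> (\<Sum>i\<in>V. c i powr 0)"
      using V(1) by (intro member_le_sum) auto
    then show ?thesis using i by simp
  qed
  ultimately show ?thesis
    using IVT2'[of "\<lambda>x. \<Sum>i\<in>V. c i powr x" 1 1 0] cont by fastforce
qed

lemma summable_prod_of_tendsto_less_1:
  fixes S :: "nat \<Rightarrow> real"
  assumes "\<And>k. 0 \<le> S k" "S \<longlonglongrightarrow> l" "l < 1"
  shows "summable (\<lambda>n. \<Prod>k<n. S k)"
proof -
  obtain r where r: "l < r" "r < 1" using dense[OF assms(3)] by blast
  obtain N where N: "\<And>k. k \<ge> N \<Longrightarrow> S k < r"
    using order_tendstoD(2)[OF assms(2) r(1)] unfolding eventually_sequentially by blast
  show ?thesis
  proof (rule summable_ratio_test[OF r(2), of N])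
    fix n assume "N \<le> n"
    then show "norm (\<Prod>k<Suc n. S k) \<le> r * norm (\<Prod>k<n. S k)"
      using N[of n] assms(1) by (simp add: abs_mult prod_nonneg mult_right_mono mult.commute)
  qed
qed

lemma cyl_length_powr: "cyl_length q a n powr t = (\<Prod>k<n. q (a k) k powr t)"
  by (simp add: cyl_length_def prod_powr_distrib)

section \<open>Matrices with convergent rows\<close>

locale Q_tilde_limit = Q_tilde +
  fixes q_lim :: "nat \<Rightarrow> real"
  assumes q_lim: "i < s \<Longrightarrow> (q i) \<longlonglongrightarrow> q_lim i"
begin

lemma q_lim_nonneg: "i < s \<Longrightarrow> 0 \<le> q_lim i"
  using q_pos by (intro LIMSEQ_le_const[OF q_lim]) (auto intro: less_imp_le)

lemma q_lim_sum: "(\<Sum>i<s. q_lim i) = 1"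
proof -
  have "(\<lambda>k. \<Sum>i<s. q i k) \<longlonglongrightarrow> (\<Sum>i<s. q_lim i)"
    using q_lim by (intro tendsto_sum) auto
  then show ?thesis using q_sum by (simp add: LIMSEQ_const_iff)
qed

lemma tendsto_sum_q_powr:
  assumes "V \<subseteq> {..<s}" "0 < t"
  shows "(\<lambda>k. \<Sum>i\<in>V. q i k powr t) \<longlonglongrightarrow> (\<Sum>i\<in>V. q_lim i powr t)"
  using assms q_lim q_pos
  by (intro tendsto_sum tendsto_powr2 tendsto_const) (auto intro!: always_eventually less_imp_le)

lemma Gamma_set_eq: "V \<subseteq> {..<s} \<Longrightarrow> Gamma_set q V = Q_point q ` {a. \<forall>k. a k \<in> V}"
  unfolding Gamma_set_def using Q_point_in_unit_interval by fastforce

lemma M_set_eq: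
  "M_set s q \<nu> = Q_point q ` {a. (\<forall>k. a k < s) \<and>
      (\<forall>i<s. (\<lambda>n. real (symbol_count a i n) / real n) \<longlonglongrightarrow> \<nu> i)}"
  unfolding M_set_def using Q_point_in_unit_interval by fastforce

section \<open>Restricted symbols\<close>

text \<open>
  With the normalised weights \<open>q i k powr t / S k\<close>, the \<open>t\<close>-th power of the length of a cylinder is
  exactly its weight times \<open>\<Prod>k<n. S k\<close>, and these products are summable because the limit of \<open>S\<close> is
  less than 1.
\<close>

lemma hausdorff_measure_Gamma_zero:
  assumes V: "V \<subseteq> {..<s}" "V \<noteq> {}" and t: "0 < t" and less: "(\<Sum>i\<in>V. q_lim i powr t) < 1"
  shows "hausdorff_measure t (Gamma_set q V) = 0"
proof -
  define S where "S k = (\<Sum>i\<in>V. q i k powr t)" for k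
  have fin: "finite V" using V finite_subset by blast
  have S: "0 < S k" for k
    unfolding S_def using V q_pos fin by (intro sum_pos) (auto simp: powr_gt_zero less_imp_neq[THEN not_sym])
  have S': "S \<longlonglongrightarrow> (\<Sum>i\<in>V. q_lim i powr t)"
    unfolding S_def[abs_def] by (rule tendsto_sum_q_powr[OF V(1) t])
  show ?thesis
    unfolding Gamma_set_eq[OF V(1)]
  proof (rule hausdorff_measure_zero_of_weights[where p = "\<lambda>i k. q i k powr t / S k"
        and c = "\<lambda>n. \<Prod>k<n. S k", OF V(1) t])
    show "(\<Sum>i\<in>V. q i k powr t / S k) \<le> 1" for k
      using S[of k] by (simp add: sum_divide_distrib[symmetric] S_def[symmetric])
    show "summable (\<lambda>n. \<Prod>k<n. S k)"
      using S S' less by (intro summable_prod_of_tendsto_less_1) (auto intro: less_imp_le)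
    show "\<forall>\<^sub>F n in sequentially. cyl_length q a n powr t
        \<le> (\<Prod>k<n. S k) * (\<Prod>k<n. q (a k) k powr t / S k)" if "a \<in> {a. \<forall>k. a k \<in> V}" for a
      using S by (auto intro!: always_eventually simp: prod.distrib[symmetric] cyl_length_powr
          less_imp_neq[THEN not_sym])
  qed (auto intro!: prod_nonneg divide_nonneg_nonneg less_imp_le[OF S])
qed

text \<open>
  The mass is distributed by the weights \<open>q i k powr x / S k\<close>, restricted to the symbols with
  positive limit: the other symbols do not contribute to the equation for \<open>x\<close>, and without them the
  entries are bounded below. The normalising factors \<open>S k\<close> tend to 1, but their product need not
  converge; the gap between \<open>t\<close> and \<open>x\<close> absorbs it.
\<close>

lemma hausdorff_measure_Gamma_pos:
  assumes V: "V \<subseteq> {..<s}" and lt1: "\<And>i. i \<in> V \<Longrightarrow> q_lim i < 1"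
    and t: "0 < t" "t < x" and root: "(\<Sum>i\<in>V. q_lim i powr x) = 1"
  shows "hausdorff_measure t (Gamma_set q V) \<noteq> 0"
proof -
  define W where "W = {i\<in>V. 0 < q_lim i}"
  have W: "W \<subseteq> {..<s}" "finite W" using V finite_subset[OF V] by (auto simp: W_def)
  have x: "0 < x" using t by simp
  have rootW: "(\<Sum>i\<in>W. q_lim i powr x) = 1"
  proof -
    have "0 \<le> q_lim i" if "i \<in> V" for i using that V q_lim_nonneg by blast
    then have "(\<Sum>i\<in>W. q_lim i powr x) = (\<Sum>i\<in>V. q_lim i powr x)"
      using finite_subset[OF V] by (intro sum.mono_neutral_left) (auto simp: W_def order_less_le)
    then show ?thesis using root by simp
  qed
  then have "W \<noteq> {}" by auto
  define S where "S k = (\<Sum>i\<in>W. q i k powr x)" for k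
  have S: "0 < S k" for k
    unfolding S_def using W \<open>W \<noteq> {}\<close> q_pos
    by (intro sum_pos) (auto simp: powr_gt_zero less_imp_neq[THEN not_sym])
  have S1: "S \<longlonglongrightarrow> 1"
    using tendsto_sum_q_powr[OF W(1) x] by (simp add: S_def[abs_def] rootW)
  have "\<exists>P. \<forall>i. pmf P i = (if i \<in> W then q i k powr x / S k else 0)" for k
    using S[of k] W(2)
    by (intro finite_pmf_exists) (auto simp: sum_divide_distrib[symmetric] S_def[symmetric])
  then obtain P where P: "\<And>k i. pmf (P k) i = (if i \<in> W then q i k powr x / S k else 0)" by metis
  have "i < s" if "i \<in> W" for i using that W(1) by blast
  then have "\<exists>b>0. \<forall>i\<in>W. \<forall>k. b \<le> q i k"
    using q_pos q_lim by (intro uniform_pos_lower_bound[OF W(2), where l = q_lim]) (simp_all add: W_def)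
  then obtain b where b: "0 < b" "\<And>i k. i \<in> W \<Longrightarrow> b \<le> q i k" by blast
  \<comment> \<open>from some position on, a further symbol cannot increase the mass divided by
    the \<open>t\<close>-th power of the length\<close>
  have "\<forall>\<^sub>F k in sequentially. \<forall>i\<in>W. q i k powr (x - t) \<le> S k"
  proof (rule eventually_ball_finite[OF W(2)], rule ballI)
    fix i assume i: "i \<in> W"
    have "(\<lambda>k. S k - q i k powr (x - t)) \<longlonglongrightarrow> 1 - q_lim i powr (x - t)"
      using i W q_lim S1 by (intro tendsto_intros) (auto simp: W_def)
    moreover have "q_lim i powr (x - t) < 1"
      using i lt1[of i] t by (simp add: W_def powr_def mult_pos_neg)
    ultimately have "\<forall>\<^sub>F k in sequentially. 0 < S k - q i k powr (x - t)"
      by (intro order_tendstoD) auto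
    then show "\<forall>\<^sub>F k in sequentially. q i k powr (x - t) \<le> S k"
      by eventually_elim simp
  qed
  then obtain N where N: "\<And>k i. k \<ge> N \<Longrightarrow> i \<in> W \<Longrightarrow> q i k powr (x - t) \<le> S k"
    unfolding eventually_sequentially by blast
  have bounded: "\<exists>C::nat. \<forall>n. (\<Prod>k<n. pmf (P k) (a k)) \<le> real C * cyl_length q a n powr t"
    if a: "\<forall>k. a k \<in> W" for a
  proof -
    define R where "R n = (\<Prod>k<n. q (a k) k powr (x - t) / S k)" for n
    have R0: "0 \<le> R n" for n 
      unfolding R_def by (auto intro!: prod_nonneg divide_nonneg_nonneg less_imp_le[OF S])
    have eq: "(\<Prod>k<n. pmf (P k) (a k)) = R n * cyl_length q a n powr t" for n
      unfolding R_def cyl_length_powr prod.distrib[symmetric]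
      using a by (intro prod.cong) (auto simp: P powr_add[symmetric])
    have "R n \<le> R N" if "N \<le> n" for n
      using that
    proof (induction n rule: dec_induct)
      case (step n)
      have "R (Suc n) = R n * (q (a n) n powr (x - t) / S n)" by (simp add: R_def)
      also have "\<dots> \<le> R n * 1"
        using N[of n "a n"] step a S[of n] R0 by (intro mult_left_mono) (auto simp: divide_le_eq)
      finally show ?case using step.IH by simp
    qed simp
    then have "\<forall>\<^sub>F n in sequentially. R n \<le> R N"
      unfolding eventually_sequentially by blast
    then obtain C :: nat where "\<And>n. R n \<le> real C"
      using eventually_le_imp_nat_bound by blast
    then show ?thesis unfolding eq by (intro exI[of _ C] allI mult_right_mono) auto
  qed
  have "AE a in PiM UNIV (\<lambda>k. measure_pmf (P k)). \<forall>k. a k \<in> W"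
    by (rule AE_PiM_pmf_in) (auto simp: set_pmf_iff P split: if_splits)
  then have "AE a in PiM UNIV (\<lambda>k. measure_pmf (P k)). a \<in> {a. \<forall>k. a k \<in> V} \<and> (\<forall>k. a k \<in> W) \<and>
      (\<exists>C::nat. \<forall>n. (\<Prod>k<n. pmf (P k) (a k)) \<le> real C * cyl_length q a n powr t)"
    by eventually_elim (use bounded in \<open>auto simp: W_def\<close>)
  then show ?thesis
    unfolding Gamma_set_eq[OF V] by (intro hausdorff_measure_pos_of_product_measure[OF W(1) b t(1)])
qed

lemma hausdorff_dim_Gamma_set:
  assumes V: "V \<subseteq> {..<s}" and lt1: "\<And>i. i \<in> V \<Longrightarrow> q_lim i < 1" and ex: "\<exists>i\<in>V. 0 < q_lim i"
    and root: "(\<Sum>i\<in>V. q_lim i powr x) = 1"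
  shows "hausdorff_dim (Gamma_set q V) = ereal x"
proof -
  have fin: "finite V" using V finite_subset by blast
  have nonneg: "0 \<le> q_lim i" if "i \<in> V" for i using that V q_lim_nonneg by blast
  note anti = sum_powr_strict_antimono[OF fin nonneg lt1 ex]
  have "(\<Sum>i\<in>V. q_lim i) \<le> (\<Sum>i<s. q_lim i)"
    using V q_lim_nonneg by (intro sum_mono2) auto
  then obtain y where "0 \<le> y" "(\<Sum>i\<in>V. q_lim i powr y) = 1"
    using sum_powr_eq_1_root_exists[OF fin nonneg ex] q_lim_sum by auto
  then have x: "0 \<le> x" using anti[of x y] anti[of y x] root by (cases x y rule: linorder_cases) auto
  show ?thesis
  proof (rule hausdorff_dim_eqI[OF x])
    show "hausdorff_measure t (Gamma_set q V) = 0" if "x < t" for t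
      using that x anti[of x t] root ex V by (intro hausdorff_measure_Gamma_zero) auto
    show "hausdorff_measure t (Gamma_set q V) \<noteq> 0" if "0 < t" "t < x" for t
      using hausdorff_measure_Gamma_pos[OF V lt1 that root] by blast
  qed
qed

section \<open>Prescribed frequencies\<close>

text \<open>
  The weights are the frequencies themselves, shifted by a small \<open>\<eta>\<close> so that symbols of frequency 0
  get positive weight, and normalised. The entries are replaced by upper bounds \<open>u\<close> of their limits,
  which covers a limit 0 as well. Along a sequence with frequencies \<open>\<nu>\<close> the logarithm of
  \<open>cyl_length q a n powr t\<close> divided by the weight then decreases at a linear rate. In the hypothesis,
  the convention \<open>ln 0 = 0\<close> is harmless, because the logarithm is multiplied by \<open>\<nu> i = 0\<close>.
\<close>

lemma hausdorff_measure_M_zero: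
  fixes \<nu> u :: "nat \<Rightarrow> real"
  assumes \<nu>: "\<And>i. i < s \<Longrightarrow> 0 \<le> \<nu> i" "(\<Sum>i<s. \<nu> i) = 1" and t: "0 < t"
    and u: "\<And>i. i < s \<Longrightarrow> 0 < u i" "\<And>i. i < s \<Longrightarrow> q_lim i < u i"
    and less: "t * (\<Sum>i<s. \<nu> i * ln (u i)) < (\<Sum>i<s. \<nu> i * ln (\<nu> i))"
  shows "hausdorff_measure t (M_set s q \<nu>) = 0"
proof -
  define G where "G \<eta> = t * (\<Sum>i<s. \<nu> i * ln (u i)) - (\<Sum>i<s. \<nu> i * ln (\<nu> i + \<eta>))
      + ln (1 + real s * \<eta>)" for \<eta>
  have "((\<lambda>\<eta>. \<nu> i * ln (\<nu> i + \<eta>)) \<longlongrightarrow> \<nu> i * ln (\<nu> i)) (at_right 0)" if "i < s" for i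
  proof (cases "\<nu> i = 0")
    case False
    then have "((\<lambda>\<eta>. \<nu> i * ln (\<nu> i + \<eta>)) \<longlongrightarrow> \<nu> i * ln (\<nu> i + 0)) (at_right 0)"
      by (intro tendsto_intros) auto
    then show ?thesis by simp
  qed simp
  then have "((\<lambda>\<eta>. \<Sum>i<s. \<nu> i * ln (\<nu> i + \<eta>)) \<longlongrightarrow> (\<Sum>i<s. \<nu> i * ln (\<nu> i))) (at_right 0)"
    by (intro tendsto_sum) auto
  moreover have "((\<lambda>\<eta>. ln (1 + real s * \<eta>)) \<longlongrightarrow> ln (1 + real s * 0)) (at_right 0)"
    by (intro tendsto_intros) auto
  ultimately have "(G \<longlongrightarrow> t * (\<Sum>i<s. \<nu> i * ln (u i)) - (\<Sum>i<s. \<nu> i * ln (\<nu> i))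
      + ln (1 + real s * 0)) (at_right 0)"
    unfolding G_def[abs_def] by (intro tendsto_add tendsto_diff tendsto_const)
  then have "\<forall>\<^sub>F \<eta> in at_right 0. G \<eta> < 0"
    using less by (intro order_tendstoD) auto
  moreover have "\<forall>\<^sub>F \<eta> in at_right (0::real). 0 < \<eta>"
    by (simp add: eventually_at_right_less)
  ultimately have "\<forall>\<^sub>F \<eta> in at_right (0::real). 0 < \<eta> \<and> G \<eta> < 0"
    by eventually_elim simp
  then obtain \<eta> where \<eta>: "0 < \<eta>" "G \<eta> < 0"
    using eventually_happens'[OF trivial_limit_at_right_real] by blast
  define \<gamma> where "\<gamma> = G \<eta> / 2"
  define p where "p i = (\<nu> i + \<eta>) / (1 + real s * \<eta>)" for i
  define f where "f i = t * ln (u i) - ln (p i)" for i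
  have s\<eta>: "0 < 1 + real s * \<eta>" using \<eta>(1) by (simp add: add_pos_nonneg)
  have p: "0 < p i" if "i < s" for i
    using \<nu>(1)[OF that] \<eta>(1) s\<eta> by (simp add: p_def add_nonneg_pos)
  have ln_p: "ln (p i) = ln (\<nu> i + \<eta>) - ln (1 + real s * \<eta>)" if "i < s" for i
    using \<nu>(1)[OF that] \<eta>(1) s\<eta> by (simp add: p_def ln_div add_nonneg_pos)
  have "(\<Sum>i<s. \<nu> i * f i)
      = (\<Sum>i<s. t * (\<nu> i * ln (u i)) - \<nu> i * ln (\<nu> i + \<eta>) + \<nu> i * ln (1 + real s * \<eta>))"
    by (intro sum.cong) (auto simp: f_def ln_p algebra_simps)
  also have "\<dots> = t * (\<Sum>i<s. \<nu> i * ln (u i)) - (\<Sum>i<s. \<nu> i * ln (\<nu> i + \<eta>))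
      + (\<Sum>i<s. \<nu> i) * ln (1 + real s * \<eta>)"
    by (simp only: sum.distrib sum_subtractf sum_distrib_left sum_distrib_right)
  also have "\<dots> = G \<eta>"
    by (simp add: G_def \<nu>(2))
  finally have f_sum: "(\<Sum>i<s. \<nu> i * f i) < \<gamma>" using \<eta>(2) by (simp add: \<gamma>_def)
  show ?thesis
    unfolding M_set_eq
  proof (rule hausdorff_measure_zero_of_weights[where p = "\<lambda>i k. p i"
        and c = "\<lambda>n. exp \<gamma> ^ n", OF order_refl t])
    show "(\<Sum>i<s. p i) \<le> 1"
      using s\<eta> by (simp add: p_def sum_divide_distrib[symmetric] sum.distrib \<nu>(2))
    show "summable (\<lambda>n. exp \<gamma> ^ n)"
      using \<eta>(2) by (intro summable_geometric) (simp add: \<gamma>_def)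
    fix a assume "a \<in> {a. (\<forall>k. a k < s) \<and>
      (\<forall>i<s. (\<lambda>n. real (symbol_count a i n) / real n) \<longlonglongrightarrow> \<nu> i)}"
    then have a: "\<And>k. a k < s"
      and freq: "\<And>i. i < s \<Longrightarrow> (\<lambda>n. real (symbol_count a i n) / real n) \<longlonglongrightarrow> \<nu> i" by auto
    have "\<forall>\<^sub>F n in sequentially. (\<Sum>k<n. t * ln (q (a k) k) - ln (p (a k))) \<le> \<gamma> * real n"
    proof (rule eventually_sum_along_frequencies_le[where g = "\<lambda>i k. t * ln (q i k) - ln (p i)",
          OF a freq _ f_sum])
      fix i assume i: "i < s"
      have "\<forall>\<^sub>F k in sequentially. q i k < u i"
        using order_tendstoD(2)[OF q_lim[OF i] u(2)[OF i]] .
      then show "\<forall>\<^sub>F k in sequentially. t * ln (q i k) - ln (p i) \<le> f i"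
        by eventually_elim (use t q_pos[OF i] u(1)[OF i] in \<open>auto simp: f_def intro!: mult_left_mono\<close>)
    qed
    then show "\<forall>\<^sub>F n in sequentially. cyl_length q a n powr t \<le> exp \<gamma> ^ n * (\<Prod>k<n. p (a k))"
    proof eventually_elim
      case (elim n)
      have "cyl_length q a n powr t = exp (\<Sum>k<n. t * ln (q (a k) k))"
        unfolding cyl_length_powr
        using q_pos[OF a] by (simp add: exp_sum powr_def less_imp_neq[THEN not_sym])
      also have "\<dots> \<le> exp (\<gamma> * real n + (\<Sum>k<n. ln (p (a k))))"
        using elim by (simp add: sum_subtractf)
      also have "\<dots> = exp \<gamma> ^ n * (\<Prod>k<n. p (a k))"
        using p[OF a] by (simp add: exp_add exp_sum exp_of_nat_mult[symmetric] mult.commute)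
      finally show ?case .
    qed
    show "a k \<in> {..<s}" for k using a by simp
  qed (use p in \<open>auto intro: less_imp_le\<close>)
qed

text \<open>
  By the strong law of large numbers, almost all sequences of independent symbols with distribution
  \<open>\<nu>\<close> have the frequencies \<open>\<nu>\<close>, and for such sequences the mass of a cylinder is asymptotically
  smaller than the \<open>t\<close>-th power of its length. Symbols of frequency 0 almost surely do not
  occur, so the entries in use are bounded below.
\<close>

lemma hausdorff_measure_M_pos:
  fixes \<nu> :: "nat \<Rightarrow> real"
  assumes \<nu>: "\<And>i. i < s \<Longrightarrow> 0 \<le> \<nu> i" "(\<Sum>i<s. \<nu> i) = 1" and t: "0 < t"
    and supp: "\<And>i. i < s \<Longrightarrow> 0 < \<nu> i \<Longrightarrow> 0 < q_lim i"
    and less: "(\<Sum>i<s. \<nu> i * ln (\<nu> i)) < t * (\<Sum>i<s. \<nu> i * ln (q_lim i))"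
  shows "hausdorff_measure t (M_set s q \<nu>) \<noteq> 0"
proof -
  define W where "W = {i. i < s \<and> 0 < \<nu> i}"
  have W: "W \<subseteq> {..<s}" "finite W" by (auto simp: W_def)
  have "(\<Sum>i\<in>W. \<nu> i) = (\<Sum>i<s. \<nu> i)"
    using \<nu>(1) by (intro sum.mono_neutral_left) (auto simp: W_def not_less intro: antisym)
  then obtain P where P: "\<And>i. pmf P i = (if i \<in> W then \<nu> i else 0)"
    using finite_pmf_exists[OF W(2), of \<nu>] \<nu> by (auto simp: W_def)
  have P': "pmf P i = \<nu> i" if "i < s" for i
    using \<nu>(1)[OF that] that by (auto simp: P W_def)
  obtain b where b: "0 < b" "\<And>i k. i \<in> W \<Longrightarrow> b \<le> q i k"
    using uniform_pos_lower_bound[OF W(2), of q q_lim] q_pos q_lim supp by (auto simp: W_def)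
  define \<delta> where "\<delta> = (t * (\<Sum>i<s. \<nu> i * ln (q_lim i)) - (\<Sum>i<s. \<nu> i * ln (\<nu> i))) / 2"
  have \<delta>: "0 < \<delta>" using less by (simp add: \<delta>_def)
  define g where "g i k = (if i \<in> W then ln (\<nu> i) - t * ln (q i k) else 0)" for i k
  define f where "f i = (if i \<in> W then ln (\<nu> i) - t * ln (q_lim i) + \<delta> else 0)" for i
  have gf: "\<forall>\<^sub>F k in sequentially. g i k \<le> f i" if "i < s" for i
  proof (cases "i \<in> W")
    case True
    have "q_lim i \<noteq> 0" using supp[OF that] True by (simp add: W_def)
    then have "(\<lambda>k. ln (\<nu> i) - t * ln (q i k)) \<longlonglongrightarrow> ln (\<nu> i) - t * ln (q_lim i)"
      using q_lim[OF that] by (intro tendsto_intros)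
    then have "\<forall>\<^sub>F k in sequentially. ln (\<nu> i) - t * ln (q i k) < ln (\<nu> i) - t * ln (q_lim i) + \<delta>"
      using \<delta> by (intro order_tendstoD) auto
    then show ?thesis by eventually_elim (simp add: f_def g_def True)
  qed (simp add: f_def g_def)
  have "(\<Sum>i<s. \<nu> i * f i)
      = (\<Sum>i<s. \<nu> i * ln (\<nu> i) - t * (\<nu> i * ln (q_lim i)) + \<nu> i * \<delta>)"
  proof (rule sum.cong[OF refl])
    fix i assume "i \<in> {..<s}"
    then have "i \<in> W \<or> \<nu> i = 0" using \<nu>(1)[of i] by (auto simp: W_def)
    then show "\<nu> i * f i = \<nu> i * ln (\<nu> i) - t * (\<nu> i * ln (q_lim i)) + \<nu> i * \<delta>"
      by (auto simp: f_def algebra_simps)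
  qed
  also have "\<dots> = (\<Sum>i<s. \<nu> i * ln (\<nu> i)) - t * (\<Sum>i<s. \<nu> i * ln (q_lim i)) + (\<Sum>i<s. \<nu> i) * \<delta>"
    by (simp only: sum.distrib sum_subtractf sum_distrib_left sum_distrib_right)
  also have "\<dots> = - \<delta>"
  proof -
    have "2 * \<delta> = t * (\<Sum>i<s. \<nu> i * ln (q_lim i)) - (\<Sum>i<s. \<nu> i * ln (\<nu> i))"
      by (simp add: \<delta>_def)
    then show ?thesis unfolding \<nu>(2) by linarith
  qed
  finally have f_sum: "(\<Sum>i<s. \<nu> i * f i) < 0" using \<delta> by simp
  have bounded: "\<exists>C::nat. \<forall>n. (\<Prod>k<n. pmf P (a k)) \<le> real C * cyl_length q a n powr t"
    if a: "\<forall>k. a k \<in> W"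
      and freq: "\<And>i. i < s \<Longrightarrow> (\<lambda>n. real (symbol_count a i n) / real n) \<longlonglongrightarrow> \<nu> i" for a
  proof -
    have as: "a k < s" for k using a W by blast
    have "\<forall>\<^sub>F n in sequentially. (\<Sum>k<n. g (a k) k) \<le> 0 * real n"
      by (rule eventually_sum_along_frequencies_le[OF as freq gf f_sum])
    then have "\<forall>\<^sub>F n in sequentially. exp (\<Sum>k<n. g (a k) k) \<le> 1"
      by eventually_elim simp
    then obtain C :: nat where C: "\<And>n. exp (\<Sum>k<n. g (a k) k) \<le> real C"
      using eventually_le_imp_nat_bound[of "\<lambda>n. exp (\<Sum>k<n. g (a k) k)"] by blast
    have "(\<Prod>k<n. pmf P (a k)) = exp (\<Sum>k<n. g (a k) k) * cyl_length q a n powr t" for n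
    proof -
      have "pmf P (a k) = exp (g (a k) k) * q (a k) k powr t" for k
        using a q_pos[OF as, of k k]
        by (auto simp: P g_def W_def powr_def exp_diff)
      then show ?thesis
        by (simp add: exp_sum cyl_length_powr prod.distrib)
    qed
    then show ?thesis
      using C by (intro exI[of _ C]) (auto intro!: mult_right_mono)
  qed
  have "AE a in PiM UNIV (\<lambda>_::nat. measure_pmf P). \<forall>k. a k \<in> W"
    by (rule AE_PiM_pmf_in) (auto simp: set_pmf_iff P split: if_splits)
  moreover have "AE a in PiM UNIV (\<lambda>_::nat. measure_pmf P). \<forall>i.
      (\<lambda>n. real (symbol_count a i n) / real n) \<longlonglongrightarrow> pmf P i"
    by (subst AE_all_countable) (blast intro: AE_symbol_frequency)
  ultimately have "AE a in PiM UNIV (\<lambda>_::nat. measure_pmf P).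
      a \<in> {a. (\<forall>k. a k < s) \<and> (\<forall>i<s. (\<lambda>n. real (symbol_count a i n) / real n) \<longlonglongrightarrow> \<nu> i)} \<and>
      (\<forall>k. a k \<in> W) \<and>
      (\<exists>C::nat. \<forall>n. (\<Prod>k<n. pmf P (a k)) \<le> real C * cyl_length q a n powr t)"
  proof eventually_elim
    case (elim a)
    have freq: "(\<lambda>n. real (symbol_count a i n) / real n) \<longlonglongrightarrow> \<nu> i" if "i < s" for i
      using elim(2) P'[OF that] by metis
    show ?case using elim(1) freq bounded[OF elim(1) freq] W(1) by auto
  qed
  then show ?thesis
    unfolding M_set_eq by (intro hausdorff_measure_pos_of_product_measure[OF W(1) b t])
qed

text \<open>
  A symbol of positive frequency whose entries tend to 0 makes the lengths decrease faster than
  exponentially, while the number of relevant cylinders grows only exponentially.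
\<close>

lemma hausdorff_dim_M_set_degenerate:
  fixes \<nu> :: "nat \<Rightarrow> real"
  assumes \<nu>: "\<And>i. i < s \<Longrightarrow> 0 \<le> \<nu> i" "(\<Sum>i<s. \<nu> i) = 1"
    and j: "j < s" "0 < \<nu> j" "q_lim j = 0"
  shows "hausdorff_dim (M_set s q \<nu>) = 0"
proof -
  have "hausdorff_measure t (M_set s q \<nu>) = 0" if t: "0 < t" for t
  proof -
    define H where "H = (\<Sum>i<s. \<nu> i * ln (\<nu> i))"
    define K where "K = (\<Sum>i\<in>{..<s} - {j}. \<nu> i * ln (q_lim i + 1))"
    \<comment> \<open>this value of \<open>u j\<close> makes the \<open>\<nu>\<close>-mean of \<open>ln u\<close> equal to \<open>H / t - 1\<close>\<close>
    define e where "e = exp ((H / t - K - 1) / \<nu> j)"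
    define u where "u i = (if i = j then e else q_lim i + 1)" for i
    have "(\<Sum>i<s. \<nu> i * ln (u i)) = \<nu> j * ln e + K"
      using j(1) by (simp add: sum.remove[of "{..<s}" j] u_def K_def)
    also have "\<dots> = H / t - 1" using j(2) by (simp add: e_def)
    finally have "t * (\<Sum>i<s. \<nu> i * ln (u i)) < H"
      using t by (simp add: field_simps)
    moreover have "0 < u i" "q_lim i < u i" if "i < s" for i
      using q_lim_nonneg[OF that] j(3) by (auto simp: u_def e_def)
    ultimately show ?thesis
      using hausdorff_measure_M_zero[OF \<nu> t, of u] by (simp add: H_def)
  qed
  then have "hausdorff_dim (M_set s q \<nu>) = ereal 0"
    by (intro hausdorff_dim_eqI) auto
  then show ?thesis by (simp add: zero_ereal_def)
qed

lemma hausdorff_dim_M_set: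
  fixes \<nu> :: "nat \<Rightarrow> real"
  assumes \<nu>: "\<And>i. i < s \<Longrightarrow> 0 \<le> \<nu> i" "(\<Sum>i<s. \<nu> i) = 1"
    and supp: "\<And>i. i < s \<Longrightarrow> 0 < \<nu> i \<Longrightarrow> 0 < q_lim i"
    and D: "(\<Sum>i<s. \<nu> i * ln (q_lim i)) < 0"
  shows "hausdorff_dim (M_set s q \<nu>)
    = ereal ((\<Sum>i<s. \<nu> i * ln (\<nu> i)) / (\<Sum>i<s. \<nu> i * ln (q_lim i)))"
proof (rule hausdorff_dim_eqI)
  let ?H = "\<Sum>i<s. \<nu> i * ln (\<nu> i)" and ?D = "\<Sum>i<s. \<nu> i * ln (q_lim i)"
  have \<nu>1: "\<nu> i \<le> 1" if "i < s" for i
    using member_le_sum[of i "{..<s}" \<nu>] that \<nu> by auto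
  have "\<nu> i * ln (\<nu> i) \<le> 0" if "i < s" for i
    using \<nu>(1)[OF that] \<nu>1[OF that] by (cases "\<nu> i = 0") (auto simp: mult_nonneg_nonpos)
  then have "?H \<le> 0" by (intro sum_nonpos) auto
  then show "0 \<le> ?H / ?D" using D by (simp add: divide_nonpos_neg)
  then have t0: "0 < t" if "?H / ?D < t" for t using that by simp
  show "hausdorff_measure t (M_set s q \<nu>) = 0" if t: "?H / ?D < t" for t
  proof -
    have less: "t * ?D < ?H" using t D by (simp add: divide_less_eq)
    have "((\<lambda>\<eta>. \<nu> i * ln (q_lim i + \<eta>)) \<longlongrightarrow> \<nu> i * ln (q_lim i)) (at_right 0)" if "i < s" for i
    proof (cases "\<nu> i = 0")
      case False
      then have "0 < q_lim i" using supp[OF that] \<nu>(1)[OF that] by simp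
      then have "((\<lambda>\<eta>. \<nu> i * ln (q_lim i + \<eta>)) \<longlongrightarrow> \<nu> i * ln (q_lim i + 0)) (at_right 0)"
        by (intro tendsto_intros) auto
      then show ?thesis by simp
    qed simp
    then have "((\<lambda>\<eta>. \<Sum>i<s. \<nu> i * ln (q_lim i + \<eta>)) \<longlongrightarrow> ?D) (at_right 0)"
      by (intro tendsto_sum) auto
    then have "((\<lambda>\<eta>. t * (\<Sum>i<s. \<nu> i * ln (q_lim i + \<eta>))) \<longlongrightarrow> t * ?D) (at_right 0)"
      by (rule tendsto_mult_left)
    then have "\<forall>\<^sub>F \<eta> in at_right 0. t * (\<Sum>i<s. \<nu> i * ln (q_lim i + \<eta>)) < ?H"
      using less by (intro order_tendstoD) auto
    moreover have "\<forall>\<^sub>F \<eta> in at_right (0::real). 0 < \<eta>"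
      by (simp add: eventually_at_right_less)
    ultimately have "\<forall>\<^sub>F \<eta> in at_right 0. 0 < \<eta> \<and> t * (\<Sum>i<s. \<nu> i * ln (q_lim i + \<eta>)) < ?H"
      by eventually_elim simp
    then obtain \<eta> where "0 < \<eta>" "t * (\<Sum>i<s. \<nu> i * ln (q_lim i + \<eta>)) < ?H"
      using eventually_happens'[OF trivial_limit_at_right_real] by blast
    then show ?thesis
      using q_lim_nonneg t0[OF t]
      by (intro hausdorff_measure_M_zero[OF \<nu>, where u = "\<lambda>i. q_lim i + \<eta>"]) (auto simp: add_nonneg_pos)
  qed
  show "hausdorff_measure t (M_set s q \<nu>) \<noteq> 0" if "0 < t" "t < ?H / ?D" for t
    using that D supp
    by (intro hausdorff_measure_M_pos[OF \<nu> that(1)]) (auto simp: less_divide_eq)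
qed

end

section \<open>Entropy sums in the extended reals and the dimension formulas\<close>

lemma sum_ln_ext_eq_MInfty:
  fixes \<nu> c :: "nat \<Rightarrow> real"
  assumes \<nu>: "\<And>i. i < s \<Longrightarrow> 0 \<le> \<nu> i" and j: "j < s" "0 < \<nu> j" "c j = 0"
  shows "(\<Sum>i<s. ereal (\<nu> i) * ln_ext (c i)) = - \<infinity>"
proof -
  have "ereal (\<nu> i) * ln_ext (c i) \<noteq> \<infinity>" if "i < s" for i
    using \<nu>[OF that] by (auto simp: ln_ext_def)
  then have "(\<Sum>i\<in>{..<s} - {j}. ereal (\<nu> i) * ln_ext (c i)) \<noteq> \<infinity>"
    by (auto simp: sum_Pinfty)
  moreover have "(\<Sum>i<s. ereal (\<nu> i) * ln_ext (c i))
      = - \<infinity> + (\<Sum>i\<in>{..<s} - {j}. ereal (\<nu> i) * ln_ext (c i))"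
  proof -
    have "ereal (\<nu> j) * ln_ext (c j) = - \<infinity>" using j by (simp add: ln_ext_def)
    moreover have "(\<Sum>i<s. ereal (\<nu> i) * ln_ext (c i))
        = ereal (\<nu> j) * ln_ext (c j) + (\<Sum>i\<in>{..<s} - {j}. ereal (\<nu> i) * ln_ext (c i))"
      using j(1) by (intro sum.remove) auto
    ultimately show ?thesis by (simp only:)
  qed
  ultimately show ?thesis
    by (cases "\<Sum>i\<in>{..<s} - {j}. ereal (\<nu> i) * ln_ext (c i)") simp_all
qed

text \<open>
  Where \<open>c i = 0\<close>, both products vanish, although \<^const>\<open>ln_ext\<close> and \<^const>\<open>ln\<close> have different
  values at 0.
\<close>

lemma sum_ln_ext_eq_ereal:
  fixes \<nu> c :: "nat \<Rightarrow> real"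
  assumes "\<And>i. i < s \<Longrightarrow> c i = 0 \<Longrightarrow> \<nu> i = 0"
  shows "(\<Sum>i<s. ereal (\<nu> i) * ln_ext (c i)) = ereal (\<Sum>i<s. \<nu> i * ln (c i))"
proof -
  have "(\<Sum>i<s. ereal (\<nu> i) * ln_ext (c i)) = (\<Sum>i<s. ereal (\<nu> i * ln (c i)))"
    using assms by (intro sum.cong) (auto simp: ln_ext_def zero_ereal_def[symmetric])
  then show ?thesis by simp
qed

theorem theorem1:
  fixes s :: nat and q :: "nat \<Rightarrow> nat \<Rightarrow> real" and q_lim :: "nat \<Rightarrow> real"
    and V0 :: "nat set" and \<nu> :: "nat \<Rightarrow> real"
  assumes "2 \<le> s"
    and "Q_tilde_matrix s q"
    and "\<forall>i<s. (\<lambda>k. q i k) \<longlonglongrightarrow> q_lim i"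
    and "V0 \<subseteq> {..<s}"
    and "\<forall>i<s. 0 \<le> \<nu> i" and "(\<Sum>i<s. \<nu> i) = 1"
  shows "((\<exists>i\<in>V0. 0 < q_lim i) \<and> (\<forall>i\<in>V0. q_lim i < 1) \<longrightarrow>
            (\<exists>!x::real. (\<Sum>i\<in>V0. q_lim i powr x) = 1) \<and>
            (\<forall>x::real. (\<Sum>i\<in>V0. q_lim i powr x) = 1 \<longrightarrow>
               hausdorff_dim (Gamma_set q V0) = ereal x)) \<and>
         ((\<Sum>i<s. ereal (\<nu> i) * ln_ext (q_lim i)) \<noteq> 0 \<longrightarrow>
            hausdorff_dim (M_set s q \<nu>) =
              (\<Sum>i<s. ereal (\<nu> i) * ln_ext (\<nu> i)) /
              (\<Sum>i<s. ereal (\<nu> i) * ln_ext (q_lim i)))"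
proof (intro conjI impI)
  interpret Q_tilde_limit s q q_lim
    using assms by unfold_locales auto
  note V = assms(4)
  have fin: "finite V0" using V finite_subset by blast
  have nonneg: "0 \<le> q_lim i" if "i \<in> V0" for i using that V q_lim_nonneg by blast
  have \<nu>: "\<And>i. i < s \<Longrightarrow> 0 \<le> \<nu> i" "(\<Sum>i<s. \<nu> i) = 1" using assms by auto
  {
    assume *: "(\<exists>i\<in>V0. 0 < q_lim i) \<and> (\<forall>i\<in>V0. q_lim i < 1)"
    have "(\<Sum>i\<in>V0. q_lim i) \<le> (\<Sum>i<s. q_lim i)"
      using V q_lim_nonneg by (intro sum_mono2) auto
    then obtain y where y: "(\<Sum>i\<in>V0. q_lim i powr y) = 1"
      using sum_powr_eq_1_root_exists[of V0 q_lim] fin nonneg * q_lim_sum by auto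
    have "x = y" if "(\<Sum>i\<in>V0. q_lim i powr x) = 1" for x
      using sum_powr_strict_antimono[of V0 q_lim x y] sum_powr_strict_antimono[of V0 q_lim y x]
        fin nonneg * y that
      by (cases x y rule: linorder_cases) auto
    then show "\<exists>!x::real. (\<Sum>i\<in>V0. q_lim i powr x) = 1" using y by blast
    show "\<forall>x::real. (\<Sum>i\<in>V0. q_lim i powr x) = 1 \<longrightarrow> hausdorff_dim (Gamma_set q V0) = ereal x"
      using hausdorff_dim_Gamma_set[OF V] * by blast
  next
    assume D: "(\<Sum>i<s. ereal (\<nu> i) * ln_ext (q_lim i)) \<noteq> 0"
    have H: "(\<Sum>i<s. ereal (\<nu> i) * ln_ext (\<nu> i)) = ereal (\<Sum>i<s. \<nu> i * ln (\<nu> i))"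
      by (rule sum_ln_ext_eq_ereal)
    show "hausdorff_dim (M_set s q \<nu>) = (\<Sum>i<s. ereal (\<nu> i) * ln_ext (\<nu> i)) /
              (\<Sum>i<s. ereal (\<nu> i) * ln_ext (q_lim i))"
    proof (cases "\<exists>j<s. 0 < \<nu> j \<and> q_lim j = 0")
      case True
      then obtain j where j: "j < s" "0 < \<nu> j" "q_lim j = 0" by blast
      have "(\<Sum>i<s. ereal (\<nu> i) * ln_ext (q_lim i)) = - \<infinity>"
        by (rule sum_ln_ext_eq_MInfty[where j = j]) (use \<nu>(1) j in auto)
      moreover have "hausdorff_dim (M_set s q \<nu>) = 0"
        by (rule hausdorff_dim_M_set_degenerate[OF \<nu> j])
      ultimately show ?thesis unfolding H by simp
    next
      case False
      then have supp: "0 < q_lim i" if "i < s" "0 < \<nu> i" for i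
        using that q_lim_nonneg[of i] by (auto simp: order_less_le)
      have eq: "(\<Sum>i<s. ereal (\<nu> i) * ln_ext (q_lim i)) = ereal (\<Sum>i<s. \<nu> i * ln (q_lim i))"
        using False \<nu>(1) by (intro sum_ln_ext_eq_ereal) (auto simp: order_less_le)
      have "q_lim i \<le> 1" if "i < s" for i
        using member_le_sum[of i "{..<s}" q_lim] that q_lim_nonneg q_lim_sum by auto
      then have "\<nu> i * ln (q_lim i) \<le> 0" if "i < s" for i
        using that \<nu>(1)[OF that] q_lim_nonneg[OF that]
        by (cases "q_lim i = 0") (auto simp: mult_nonneg_nonpos)
      then have "(\<Sum>i<s. \<nu> i * ln (q_lim i)) \<le> 0" by (intro sum_nonpos) auto
      then have "(\<Sum>i<s. \<nu> i * ln (q_lim i)) < 0"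
        using D unfolding eq by (simp add: order_less_le zero_ereal_def)
      then have "hausdorff_dim (M_set s q \<nu>)
          = ereal ((\<Sum>i<s. \<nu> i * ln (\<nu> i)) / (\<Sum>i<s. \<nu> i * ln (q_lim i)))"
        by (intro hausdorff_dim_M_set \<nu> supp)
      then show ?thesis
        unfolding H eq using D by (simp add: eq)
    qed
  }
qed

end
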